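(* Let $k\ge 1$ be an integer and let $D$ be a rooted digraph with root $r$ which is reduced (none of the reduction rules (0)–(3) below applies) and has at least $(3k-2)(30k-2)$ vertices. Then $D$ has an outbranching rooted at $r$ with at least $k$ leaves. Rules: (0) some vertex of $D$ is not reachable from $r$ by a directed path (then the instance is replaced by a trivially FALSE one); (1) $x$ is a cutvertex of $D$: delete $x$ and add an arc $(v,z)$ for every $v\in N^-(x)$ and $z\in N^+(x)\setminus\{v\}$; (2) $P$ is a bipath of length 4: contract two consecutive internal vertices of $P$; (3) $x$ is a vertex and some $y\in N^-(x)$ is such that $N^-(x)\setminus\{y\}$ cuts $y$ from $r$ (every directed path from $r$ to $y$ meets $N^-(x)\setminus\{y\}$): delete the arc $(y,x)$.
   Context: A rooted digraph is a loopless digraph $D$ with a distinguished vertex $r$ (the root) such that: there is no arc $(u,r)$ for any $u\in V(D)$; there is no arc $(x,y)$ with $x\neq r$ and $y$ an outneighbour of $r$; and $r$ has outdegree at least 2. $N^-(x)$, $N^+(x)$ are the in- and out-neighbourhoods of $x$. A cut of $D$ is a set $S\subseteq V(D)\setminus\{r\}$ such that some vertex $z\notin S$ is not the endpoint of any directed path starting at $r$ in $D-S$; a cutvertex is a cut of size 1. A sequence of distinct vertices $(x_1,\dots,x_l)$, $l\ge 3$, is a bipath of length $l-1$ if the set of arcs incident to $\{x_2,\dots,x_{l-1}\}$ is exactly $\{(x_i,x_{i+1}),(x_{i+1},x_i):1\le i\le l-1\}$. An outbranching of $D$ is a spanning subdigraph which is a directed tree rooted at $r$ with all arcs directed away from $r$;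 its leaves are its vertices of outdegree 0. *)

theory Defs
  imports Main
begin

text \<open>A digraph is given by a finite vertex set V and an arc set A (pairs, no multiple arcs).\<close>

definition in_nbrs :: "('a \<times> 'a) set \<Rightarrow> 'a \<Rightarrow> 'a set" where
  "in_nbrs A x = {u. (u, x) \<in> A}"

definition out_nbrs :: "('a \<times> 'a) set \<Rightarrow> 'a \<Rightarrow> 'a set" where
  "out_nbrs A x = {v. (x, v) \<in> A}"

definition rooted_digraph :: "'a set \<Rightarrow> ('a \<times> 'a) set \<Rightarrow> 'a \<Rightarrow> bool" where
  "rooted_digraph V A r \<longleftrightarrow>
     finite V \<and> A \<subseteq> V \<times> V \<and> r \<in> V \<and>
     (\<forall>x. (x, x) \<notin> A) \<and>
     (\<forall>u. (u, r) \<notin> A) \<and>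
     (\<forall>x y. (x, y) \<in> A \<and> x \<noteq> r \<longrightarrow> y \<notin> out_nbrs A r) \<and>
     card (out_nbrs A r) \<ge> 2"

text \<open>Reachability from u to v in D - S (vertices of S deleted); requires u, v not in S.\<close>
definition reach_avoiding :: "'a set \<Rightarrow> ('a \<times> 'a) set \<Rightarrow> 'a set \<Rightarrow> 'a \<Rightarrow> 'a \<Rightarrow> bool" where
  "reach_avoiding V A S u v \<longleftrightarrow>
     u \<in> V - S \<and> v \<in> V - S \<and> (u, v) \<in> (A \<inter> ((V - S) \<times> (V - S)))\<^sup>*"

definition is_cut :: "'a set \<Rightarrow> ('a \<times> 'a) set \<Rightarrow> 'a \<Rightarrow> 'a set \<Rightarrow> bool" where
  "is_cut V A r S \<longleftrightarrow> S \<subseteq> V - {r} \<and> (\<exists>z \<in> V - S. \<not> reach_avoiding V A S r z)"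

definition is_cutvertex :: "'a set \<Rightarrow> ('a \<times> 'a) set \<Rightarrow> 'a \<Rightarrow> 'a \<Rightarrow> bool" where
  "is_cutvertex V A r x \<longleftrightarrow> is_cut V A r {x}"

text \<open>S cuts y from r: every directed path from r to y meets S.\<close>
definition cuts_from_root :: "'a set \<Rightarrow> ('a \<times> 'a) set \<Rightarrow> 'a \<Rightarrow> 'a set \<Rightarrow> 'a \<Rightarrow> bool" where
  "cuts_from_root V A r S y \<longleftrightarrow> \<not> reach_avoiding V A S r y"

text \<open>A bipath (x_1,...,x_l), l >= 3, of length l-1, given as a list.\<close>
definition is_bipath :: "'a set \<Rightarrow> ('a \<times> 'a) set \<Rightarrow> 'a list \<Rightarrow> bool" where
  "is_bipath V A xs \<longleftrightarrow>
     length xs \<ge> 3 \<and> distinct xs \<and> set xs \<subseteq> V \<and>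
     {a \<in> A. fst a \<in> set (butlast (tl xs)) \<or> snd a \<in> set (butlast (tl xs))} =
       {(xs ! i, xs ! (i + 1)) | i. i + 1 < length xs} \<union>
       {(xs ! (i + 1), xs ! i) | i. i + 1 < length xs}"

definition rule0_applies :: "'a set \<Rightarrow> ('a \<times> 'a) set \<Rightarrow> 'a \<Rightarrow> bool" where
  "rule0_applies V A r \<longleftrightarrow> (\<exists>z \<in> V. (r, z) \<notin> A\<^sup>*)"

definition rule1_applies :: "'a set \<Rightarrow> ('a \<times> 'a) set \<Rightarrow> 'a \<Rightarrow> bool" where
  "rule1_applies V A r \<longleftrightarrow> (\<exists>x. is_cutvertex V A r x)"

definition rule2_applies :: "'a set \<Rightarrow> ('a \<times> 'a) set \<Rightarrow> 'a \<Rightarrow> bool" where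
  "rule2_applies V A r \<longleftrightarrow> (\<exists>xs. is_bipath V A xs \<and> length xs - 1 = 4)"

definition rule3_applies :: "'a set \<Rightarrow> ('a \<times> 'a) set \<Rightarrow> 'a \<Rightarrow> bool" where
  "rule3_applies V A r \<longleftrightarrow>
     (\<exists>x \<in> V. \<exists>y \<in> in_nbrs A x. cuts_from_root V A r (in_nbrs A x - {y}) y)"

definition reduced :: "'a set \<Rightarrow> ('a \<times> 'a) set \<Rightarrow> 'a \<Rightarrow> bool" where
  "reduced V A r \<longleftrightarrow>
     \<not> rule0_applies V A r \<and> \<not> rule1_applies V A r \<and>
     \<not> rule2_applies V A r \<and> \<not> rule3_applies V A r"

text \<open>Outbranching: spanning subdigraph (arc set B within A) which is a directed tree
  rooted at r with arcs directed away from r.\<close>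
definition is_outbranching :: "'a set \<Rightarrow> ('a \<times> 'a) set \<Rightarrow> 'a \<Rightarrow> ('a \<times> 'a) set \<Rightarrow> bool" where
  "is_outbranching V A r B \<longleftrightarrow>
     B \<subseteq> A \<and>
     in_nbrs B r = {} \<and>
     (\<forall>v \<in> V - {r}. card (in_nbrs B v) = 1) \<and>
     (\<forall>v \<in> V. (r, v) \<in> B\<^sup>*)"

definition leaves :: "'a set \<Rightarrow> ('a \<times> 'a) set \<Rightarrow> 'a set" where
  "leaves V B = {v \<in> V. out_nbrs B v = {}}"

end

theory Submission
  imports Defs Complex_Main "HOL-Library.Sublist"
begin

text \<open>Without cutvertices, the vertices other than \<open>r\<close> can be numbered so that each vertex that
  is not an outneighbour of \<open>r\<close> has both a smaller and a larger inneighbour. The arcs that increase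
  (or decrease) the numbering form an acyclic digraph, in which any choice of parents is an outbranching; choosing
  the parents in a small transversal of the inneighbourhoods turns many vertices of indegree at least 2 into many
  leaves. Applied to acyclic digraphs built from a forward tree and a backward tree, this shows that if no
  outbranching has more than \<open>l\<close> leaves, then all but \<open>24 l\<close> of the numbered vertices
  that are not outneighbours of \<open>r\<close> have exactly two inneighbours, both joined by opposite arcs. Rule
  (3) bounds every indegree by \<open>l\<close>, so at most \<open>24 l * l\<close> of these regular vertices have
  an arc to one of the special ones, and by rule (2) each remaining vertex is adjacent to such a vertex.\<close>

subsection \<open>Numberings\<close>

text \<open>For \<open>U\<close> the set of vertices other than the root and its outneighbours, this is the
  absence of unreachable vertices and of cutvertices, phrased without paths.\<close>

definition doubly_entered :: "('a \<times> 'a) set \<Rightarrow> 'a set \<Rightarrow> bool" where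
  "doubly_entered A U \<longleftrightarrow>
     (\<forall>X c. X \<subseteq> U \<longrightarrow> X \<noteq> {} \<longrightarrow> (\<exists>q v. (q, v) \<in> A \<and> v \<in> X \<and> q \<notin> X \<and> q \<noteq> c))"

lemma doubly_enteredD:
  "doubly_entered A U \<Longrightarrow> X \<subseteq> U \<Longrightarrow> X \<noteq> {} \<Longrightarrow> \<exists>q v. (q, v) \<in> A \<and> v \<in> X \<and> q \<notin> X \<and> q \<noteq> c"
  unfolding doubly_entered_def by blast

text \<open>The deletion fails because of a set whose remaining entering arcs all start at one
  vertex \<open>t\<close>. In \<open>A\<close> some entering arc does not start at \<open>t\<close>,
  so it is \<open>(y, x)\<close>, and some entering arc does not start at \<open>y\<close>, which
  puts \<open>t\<close> outside the set.\<close>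

lemma undeletable_arc:
  assumes A: "doubly_entered A U" and del: "\<not> doubly_entered (A - {(y, x)}) U"
  obtains X t where "X \<subseteq> U" "x \<in> X" "y \<notin> X" "y \<noteq> t" "t \<notin> X"
    "\<And>q v. (q, v) \<in> A \<Longrightarrow> v \<in> X \<Longrightarrow> q \<notin> X \<Longrightarrow> q = t \<or> (q = y \<and> v = x)"
proof -
  obtain X t where X: "X \<subseteq> U" "X \<noteq> {}"
    and only: "\<And>q v. (q, v) \<in> A \<Longrightarrow> v \<in> X \<Longrightarrow> q \<notin> X \<Longrightarrow> q = t \<or> (q = y \<and> v = x)"
    using del unfolding doubly_entered_def by blast
  obtain q v where "(q, v) \<in> A" "v \<in> X" "q \<notin> X" "q \<noteq> t"
    using doubly_enteredD[OF A X] by blast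
  with only have qv: "q = y" "v = x" by blast+
  obtain q' v' where "(q', v') \<in> A" "v' \<in> X" "q' \<notin> X" "q' \<noteq> y"
    using doubly_enteredD[OF A X] by blast
  with only have "q' = t" by blast
  then show thesis
    using that[of X t] X only qv \<open>v \<in> X\<close> \<open>q \<notin> X\<close> \<open>q \<noteq> t\<close> \<open>q' \<notin> X\<close> by blast
qed

text \<open>Uncrossing: the obstructions \<open>X1\<close> and \<open>X2\<close> to the two
  deletions both contain \<open>x\<close>. That their union has two entering tails restricts
  \<open>t1\<close> and \<open>t2\<close> so far that \<open>y3\<close> lies in both sets and their
  intersection without \<open>x\<close> is entered from \<open>x\<close> only.\<close>

lemma doubly_entered_deletable:
  assumes A: "doubly_entered A U" and x: "x \<in> U"
    and arcs: "(y1, x) \<in> A" "(y2, x) \<in> A" "(y3, x) \<in> A"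
    and dist: "y1 \<noteq> y2" "y1 \<noteq> y3" "y2 \<noteq> y3"
    and irr: "\<And>v. (v, v) \<notin> A"
  shows "doubly_entered (A - {(y1, x)}) U \<or> doubly_entered (A - {(y2, x)}) U"
proof (rule ccontr)
  assume "\<not> ?thesis"
  then have n1: "\<not> doubly_entered (A - {(y1, x)}) U" and n2: "\<not> doubly_entered (A - {(y2, x)}) U"
    by auto
  obtain X1 t1 where 1: "X1 \<subseteq> U" "x \<in> X1" "y1 \<notin> X1" "y1 \<noteq> t1" "t1 \<notin> X1"
    "\<And>q v. (q, v) \<in> A \<Longrightarrow> v \<in> X1 \<Longrightarrow> q \<notin> X1 \<Longrightarrow> q = t1 \<or> (q = y1 \<and> v = x)"
    using undeletable_arc[OF A n1] by blast
  obtain X2 t2 where 2: "X2 \<subseteq> U" "x \<in> X2" "y2 \<notin> X2" "y2 \<noteq> t2" "t2 \<notin> X2"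
    "\<And>q v. (q, v) \<in> A \<Longrightarrow> v \<in> X2 \<Longrightarrow> q \<notin> X2 \<Longrightarrow> q = t2 \<or> (q = y2 \<and> v = x)"
    using undeletable_arc[OF A n2] by blast
  have y3: "y3 \<noteq> x" using irr arcs(3) by blast
  have a: "y2 \<in> X1 \<or> y2 = t1" "y1 \<in> X2 \<or> y1 = t2" "y3 \<in> X1 \<or> y3 = t1" "y3 \<in> X2 \<or> y3 = t2"
    using 1 2 arcs dist by blast+
  \<comment> \<open>Except at \<open>x\<close>, arcs entering \<open>X1\<close> start only at
    \<open>t1\<close> and arcs entering \<open>X2\<close> only at \<open>t2\<close>; hence
    \<open>x\<close> is removed from the intersection.\<close>
  define I where "I = X1 \<inter> X2 - {x}"
  have IU: "I \<subseteq> U" "X1 \<union> X2 \<subseteq> U" "X1 \<union> X2 \<noteq> {}" using 1 2 unfolding I_def by auto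
  have un: "\<exists>q v. (q, v) \<in> A \<and> v \<in> X1 \<union> X2 \<and> q \<notin> X1 \<union> X2 \<and> q \<noteq> c" for c
    using doubly_enteredD[OF A IU(2,3)] by blast
  have int: "I \<noteq> {} \<Longrightarrow> \<exists>q v. (q, v) \<in> A \<and> v \<in> I \<and> q \<notin> I \<and> q \<noteq> x"
    using doubly_enteredD[OF A IU(1)] by blast
  have unI: "q \<in> {y1, t1, y2, t2}" if "(q, v) \<in> A" "v \<in> X1 \<union> X2" "q \<notin> X1 \<union> X2" for q v
    using that 1 2 by blast
  show False
  proof (cases "y2 \<in> X1")
    case y2: True
    show False
    proof (cases "y1 \<in> X2")
      case True
      \<comment> \<open>Both \<open>y1\<close> and \<open>y2\<close> are now inside the union, so
        \<open>t1\<close> and \<open>t2\<close> must be two different tails outside it.\<close>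
      with y2 have "q \<in> {t1, t2}" if "(q, v) \<in> A" "v \<in> X1 \<union> X2" "q \<notin> X1 \<union> X2" for q v
        using unI[OF that] that(3) by blast
      with un[of t1] un[of t2] have t: "t1 \<noteq> t2" "t1 \<notin> X2" "t2 \<notin> X1" by blast+
      then have noI: "False" if "(q, v) \<in> A" "v \<in> I" "q \<notin> I" "q \<noteq> x" for q v
        using that 1 2 y2 True unfolding I_def by (metis DiffE IntE DiffI IntI singletonD insertI1)
      have "y3 \<in> I" using a(3,4) y3 t unfolding I_def by blast
      with int noI show False by blast
    next
      case False
      then have t2: "y1 = t2" using a by blast
      then have "y3 \<in> X2" using a dist by blast
      have "t1 \<notin> X2"
      proof
        assume "t1 \<in> X2"
        then have "q = t2" if "(q, v) \<in> A" "v \<in> X1 \<union> X2" "q \<notin> X1 \<union> X2" for q v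
          using unI[OF that] that(3) t2 y2 by blast
        with un[of t2] show False by blast
      qed
      then have "y3 \<in> X1" using a \<open>y3 \<in> X2\<close> by blast
      then have "y3 \<in> I" using \<open>y3 \<in> X2\<close> y3 unfolding I_def by blast
      moreover have "False" if "(q, v) \<in> A" "v \<in> I" "q \<notin> I" "q \<noteq> x" for q v
        using that 1 2 t2 y2 \<open>t1 \<notin> X2\<close> unfolding I_def by (metis DiffE IntE DiffI IntI singletonD insertI1)
      ultimately show False using int by blast
    qed
  next
    case False
    then have t1: "y2 = t1" using a by blast
    then have "y3 \<in> X1" using a dist by blast
    have "t2 \<notin> X1"
    proof
      assume "t2 \<in> X1"
      then have "y1 \<in> X2" using a 1 by blast
      then have "q = t1" if "(q, v) \<in> A" "v \<in> X1 \<union> X2" "q \<notin> X1 \<union> X2" for q v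
        using unI[OF that] that(3) t1 \<open>t2 \<in> X1\<close> by blast
      with un[of t1] show False by blast
    qed
    then have "y3 \<in> X2" using a \<open>y3 \<in> X1\<close> by blast
    then have "y3 \<in> I" using \<open>y3 \<in> X1\<close> y3 unfolding I_def by blast
    moreover have "False" if "(q, v) \<in> A" "v \<in> I" "q \<notin> I" "q \<noteq> x" for q v
      using that 1 2 t1 \<open>t2 \<notin> X1\<close> unfolding I_def by (metis DiffE IntE DiffI IntI singletonD insertI1)
    ultimately show False using int by blast
  qed
qed

text \<open>Take \<open>B\<close> with the fewest arcs: a third inneighbour would make one of the
  arcs deletable. Indegree exactly two is what later allows arcs to be counted.\<close>

lemma sparse_doubly_entered:
  assumes A: "doubly_entered A U" and fin: "finite A" and irr: "\<And>v. (v, v) \<notin> A"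
  obtains B where "B \<subseteq> A" "doubly_entered B U"
    "\<And>x. x \<in> U \<Longrightarrow> \<exists>y1 y2. y1 \<noteq> y2 \<and> {q. (q, x) \<in> B} = {y1, y2}"
proof -
  let ?P = "\<lambda>B. B \<subseteq> A \<and> doubly_entered B U"
  obtain B where B: "?P B" and min: "\<And>C. ?P C \<Longrightarrow> card B \<le> card C"
    using ex_has_least_nat[of ?P A card] A by blast
  have finB: "finite B" using B fin finite_subset by blast
  have irrB: "\<And>v. (v, v) \<notin> B" using B irr by blast
  show thesis
  proof (rule that[of B])
    fix x assume x: "x \<in> U"
    obtain y1 where y1: "(y1, x) \<in> B"
      using doubly_enteredD[of B U "{x}"] B x by blast
    obtain y2 where y2: "(y2, x) \<in> B" "y2 \<noteq> y1"
      using doubly_enteredD[of B U "{x}" y1] B x by blast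
    have "y3 = y1 \<or> y3 = y2" if "(y3, x) \<in> B" for y3
    proof (rule ccontr)
      assume "\<not> ?thesis"
      then have "doubly_entered (B - {(y1, x)}) U \<or> doubly_entered (B - {(y2, x)}) U"
        using doubly_entered_deletable[of B U x y1 y2 y3] B x y1 y2 that irrB by auto
      then show False
        using min[of "B - {(y1, x)}"] min[of "B - {(y2, x)}"] B y1 y2
          card_Diff1_less[OF finB y1] card_Diff1_less[OF finB y2(1)] by auto
    qed
    with y1 y2 show "\<exists>y1 y2. y1 \<noteq> y2 \<and> {q. (q, x) \<in> B} = {y1, y2}" by blast
  qed (use B in auto)
qed

section \<open>Real positions and the construction of the numbering\<close>

lemma fresh_between:
  fixes a b :: real
  assumes "finite S" "a < b"
  obtains t where "a < t" "t < b" "t \<notin> S"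
proof -
  have "infinite ({a<..<b} - S)" using assms by (simp add: infinite_Ioo)
  then obtain t where "t \<in> {a<..<b} - S" using infinite_imp_nonempty by blast
  then show thesis using that by auto
qed

text \<open>Here \<open>t\<close> is the position of a vertex with inneighbours at \<open>u\<close> and \<open>v\<close> whose only arc
  goes to the vertex at \<open>z\<close>, which has one further inneighbour, at \<open>w\<close>.\<close>

lemma between_choice:
  fixes z w u v :: real
  assumes "u \<noteq> v" "\<exists>p\<in>{w, u, v}. p < z" "\<exists>q\<in>{w, u, v}. z < q" "w \<noteq> z"
  obtains a b where "a < b"
    "\<And>t. a < t \<Longrightarrow> t < b \<Longrightarrow> min u v < t \<and> t < max u v \<and> min w t < z \<and> z < max w t"
proof (cases "w < z")
  case True
  \<comment> \<open>Here \<open>w\<close> is already below \<open>z\<close>, so \<open>t\<close> has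
    to be above \<open>z\<close>; there is room because the larger of \<open>u\<close> and
    \<open>v\<close> must exceed \<open>z\<close>.\<close>
  show thesis
    by (rule that[of "max z (min u v)" "max u v"]) (use assms True in auto)
next
  case False
  show thesis
    by (rule that[of "min u v" "min z (max u v)"]) (use assms False in auto)
qed

text \<open>Induction on the number of vertices. Once all indegrees are two, counting arcs yields a
  vertex of outdegree at most one; it is contracted into its outneighbour, if any, and
  reinserted into the numbering of the smaller digraph.\<close>

lemma numbering:
  fixes W R :: "'a set"
  assumes "finite W" "R \<subseteq> W" "A \<subseteq> W \<times> (W - R)" "\<And>v. (v, v) \<notin> A" "doubly_entered A (W - R)"
  shows "\<exists>f :: 'a \<Rightarrow> real. inj_on f W \<and>
    (\<forall>v \<in> W - R. \<exists>u w. (u, v) \<in> A \<and> (w, v) \<in> A \<and> f u < f v \<and> f v < f w)"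
  using assms
proof (induction "card W" arbitrary: W R A rule: less_induct)
  case less
  note finW = less.prems(1) and RW = less.prems(2) and AW = less.prems(3)
    and irrA = less.prems(4) and deA = less.prems(5)
  have finA: "finite A" using AW finW by (meson finite_Diff finite_SigmaI finite_subset)
  obtain B where BA: "B \<subseteq> A" and deB: "doubly_entered B (W - R)"
    and two: "\<And>x. x \<in> W - R \<Longrightarrow> \<exists>y1 y2. y1 \<noteq> y2 \<and> {q. (q, x) \<in> B} = {y1, y2}"
    using sparse_doubly_entered[OF deA finA irrA] by metis
  have BW: "B \<subseteq> W \<times> (W - R)" using BA AW by blast
  have irr: "(v, v) \<notin> B" for v using BA irrA by blast
  have finB: "finite B" using finA BA finite_subset by blast
  let ?good = "\<lambda>f :: 'a \<Rightarrow> real. \<lambda>W R B. inj_on f W \<and>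
    (\<forall>v \<in> W - R. \<exists>u w. (u, v) \<in> B \<and> (w, v) \<in> B \<and> f u < f v \<and> f v < f w)"
  have "\<exists>f. ?good f W R B"
  proof (cases "W - R = {}")
    case True
    obtain g :: "'a \<Rightarrow> nat" where "inj_on g W"
      using finW finite_imp_inj_to_nat_seg by blast
    then have "inj_on (\<lambda>x. real (g x)) W" by (simp add: inj_on_def)
    with True show ?thesis by blast
  next
    case False
    have "card B = (\<Sum>v\<in>W - R. card {q. (q, v) \<in> B})"
    proof -
      \<comment> \<open>The arcs are counted twice, here by heads and below by tails.\<close>
      have "B\<inverse> = Sigma (W - R) (\<lambda>v. {q. (q, v) \<in> B})" using BW by auto
      then have "card B = card (Sigma (W - R) (\<lambda>v. {q. (q, v) \<in> B}))" by (metis card_inverse)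
      also have "\<dots> = (\<Sum>v\<in>W - R. card {q. (q, v) \<in> B})"
        using finW BW by (intro card_SigmaI) (auto intro: finite_subset[of _ W])
      finally show ?thesis .
    qed
    also have "\<dots> = (\<Sum>v\<in>W - R. 2)"
      using two by (intro sum.cong refl) (metis card_2_iff)
    finally have cardB: "card B = 2 * card (W - R)" by simp
    have cardB': "card B = (\<Sum>x\<in>W. card {z. (x, z) \<in> B})"
    proof -
      have "B = Sigma W (\<lambda>x. {z. (x, z) \<in> B})" using BW by auto
      then have "card B = card (Sigma W (\<lambda>x. {z. (x, z) \<in> B}))" by simp
      also have "\<dots> = (\<Sum>x\<in>W. card {z. (x, z) \<in> B})"
        using finW BW by (intro card_SigmaI) (auto intro: finite_subset[of _ W])
      finally show ?thesis .
    qed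
    \<comment> \<open>An arc enters \<open>W - R\<close> from outside, so \<open>R\<close> is
      nonempty and the average outdegree drops strictly below two.\<close>
    have "W - R \<subset> W"
      using doubly_enteredD[OF deB subset_refl False] BW by blast
    then have "2 * card (W - R) < 2 * card W" using finW by (simp add: psubset_card_mono)
    then have "\<exists>x\<in>W. card {z. (x, z) \<in> B} < 2"
    proof (rule contrapos_pp)
      assume "\<not> (\<exists>x\<in>W. card {z. (x, z) \<in> B} < 2)"
      then have "(\<Sum>x\<in>W. 2) \<le> (\<Sum>x\<in>W. card {z. (x, z) \<in> B})"
        by (intro sum_mono) (simp add: not_less)
      then show "\<not> 2 * card (W - R) < 2 * card W" using cardB cardB' by simp
    qed
    then obtain x where x: "x \<in> W" and c: "card {z. (x, z) \<in> B} < 2" by blast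
    have finout: "finite {z. (x, z) \<in> B}" using BW finW by (auto intro: finite_subset[of _ W])
    define W' where "W' = W - {x}"
    have W': "card W' < card W" "finite W'" "W = insert x W'" "x \<notin> W'"
      using x finW card_Diff1_less[OF finW x] unfolding W'_def by auto
    have IH: "\<exists>f :: 'a \<Rightarrow> real. inj_on f W' \<and>
        (\<forall>v \<in> W' - R'. \<exists>u w. (u, v) \<in> C \<and> (w, v) \<in> C \<and> f u < f v \<and> f v < f w)"
      if "R' \<subseteq> W'" "C \<subseteq> W' \<times> (W' - R')" "\<And>v. (v, v) \<notin> C" "doubly_entered C (W' - R')" for R' C
      using less.hyps[OF W'(1,2) that] .
    consider (none) "{z. (x, z) \<in> B} = {}" | (one) z where "{z. (x, z) \<in> B} = {z}"
      using c finout by (metis One_nat_def card_0_eq card_1_singletonE less_2_cases)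
    then show ?thesis
    proof cases
      case none
      define B' where "B' = {(q, v) \<in> B. v \<noteq> x}"
      have "doubly_entered B' (W' - (R - {x}))"
        unfolding doubly_entered_def
      proof (intro allI impI)
        fix X c assume X: "X \<subseteq> W' - (R - {x})" "X \<noteq> {}"
        then have "X \<subseteq> W - R" using W' by blast
        then obtain q v where "(q, v) \<in> B" "v \<in> X" "q \<notin> X" "q \<noteq> c"
          using X doubly_enteredD[OF deB] by blast
        moreover from this X W' have "v \<noteq> x" by blast
        ultimately show "\<exists>q v. (q, v) \<in> B' \<and> v \<in> X \<and> q \<notin> X \<and> q \<noteq> c"
          unfolding B'_def by blast
      qed
      moreover have "B' \<subseteq> W' \<times> (W' - (R - {x}))" using BW none W' unfolding B'_def by auto
      moreover have "(y, y) \<notin> B'" for y using irr unfolding B'_def by blast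
      moreover have "R - {x} \<subseteq> W'" using RW W' by blast
      ultimately obtain f :: "'a \<Rightarrow> real" where inj: "inj_on f W'"
        and f: "\<forall>v \<in> W' - (R - {x}). \<exists>u w. (u, v) \<in> B' \<and> (w, v) \<in> B' \<and> f u < f v \<and> f v < f w"
        using IH[of "R - {x}" B'] by blast
      have "\<exists>t. t \<notin> f ` W' \<and> (x \<in> W - R \<longrightarrow> (\<exists>u w. (u, x) \<in> B \<and> (w, x) \<in> B \<and> f u < t \<and> t < f w))"
      proof (cases "x \<in> W - R")
        case True
        then obtain u v where "u \<noteq> v" "{q. (q, x) \<in> B} = {u, v}"
          using two[OF True] by blast
        then have uv: "u \<noteq> v" "(u, x) \<in> B" "(v, x) \<in> B" by auto
        then have "u \<in> W'" "v \<in> W'" using BW W' irr by blast+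
        then have "f u \<noteq> f v" using inj uv by (auto simp: inj_on_def)
        then have "min (f u) (f v) < max (f u) (f v)" by auto
        then obtain t where "min (f u) (f v) < t" "t < max (f u) (f v)" "t \<notin> f ` W'"
          using fresh_between[of "f ` W'"] W' by blast
        then show ?thesis using uv by (intro exI[of _ t]) (auto simp: min_def max_def split: if_splits)
      next
        case False
        obtain t :: real where "t \<notin> f ` W'"
          using fresh_between[of "f ` W'" 0 1] W' by auto
        with False show ?thesis by blast
      qed
      then obtain t where t: "t \<notin> f ` W'"
        "x \<in> W - R \<Longrightarrow> \<exists>u w. (u, x) \<in> B \<and> (w, x) \<in> B \<and> f u < t \<and> t < f w" by blast
      have "?good (f(x := t)) W R B"
      proof (intro conjI ballI)
        show "inj_on (f(x := t)) W" using inj t W' by (auto simp: inj_on_def)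
        fix v assume v: "v \<in> W - R"
        show "\<exists>u w. (u, v) \<in> B \<and> (w, v) \<in> B \<and> (f(x := t)) u < (f(x := t)) v \<and> (f(x := t)) v < (f(x := t)) w"
        proof (cases "v = x")
          case True
          then obtain u w where "(u, x) \<in> B" "(w, x) \<in> B" "f u < t" "t < f w"
            using v t by blast
          moreover from this irr have "u \<noteq> x" "w \<noteq> x" by blast+
          ultimately show ?thesis using True by auto
        next
          case False
          then obtain u w where "(u, v) \<in> B" "(w, v) \<in> B" "f u < f v" "f v < f w"
            using f v W' unfolding B'_def by blast
          moreover from this none have "u \<noteq> x" "w \<noteq> x" by blast+
          ultimately show ?thesis using False by auto
        qed
      qed
      then show ?thesis by blast
    next
      case (one z)
      then have xz: "(x, z) \<in> B" and onlyz: "\<And>y. (x, y) \<in> B \<Longrightarrow> y = z" by auto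
      have z: "z \<in> W - R" "z \<noteq> x" "z \<in> W'" using BW xz irr W' by blast+
      obtain w where w: "w \<noteq> x" "{q. (q, z) \<in> B} = {x, w}"
      proof -
        obtain y1 y2 where "y1 \<noteq> y2" "{q. (q, z) \<in> B} = {y1, y2}" using two[OF z(1)] by blast
        moreover from this have "x = y1 \<or> x = y2" using xz by auto
        ultimately show thesis using that[of y1] that[of y2] by (auto simp: insert_commute)
      qed
      then have "(w, z) \<in> B" by auto
      then have wz: "(w, z) \<in> B" "w \<noteq> z" "w \<in> W'" using irr BW W' w(1) by blast+
      show ?thesis
      proof (cases "x \<in> R")
        case True
        \<comment> \<open>After the contraction \<open>z\<close> takes over the role of
          \<open>x\<close> in \<open>R\<close>, so it loses its in-arcs. Later \<open>x\<close> is
          placed on the side of \<open>z\<close> opposite to \<open>w\<close>.\<close>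
        define B' where "B' = {(q, v) \<in> B. q \<noteq> x \<and> v \<noteq> z}"
        define R' where "R' = insert z (R - {x})"
        have "doubly_entered B' (W' - R')"
          unfolding doubly_entered_def
        proof (intro allI impI)
          fix X c assume X: "X \<subseteq> W' - R'" "X \<noteq> {}"
          then have "X \<subseteq> W - R" using W' unfolding R'_def by blast
          then obtain q v where "(q, v) \<in> B" "v \<in> X" "q \<notin> X" "q \<noteq> c"
            using X doubly_enteredD[OF deB] by blast
          moreover from this X have "v \<noteq> z" unfolding R'_def by blast
          ultimately show "\<exists>q v. (q, v) \<in> B' \<and> v \<in> X \<and> q \<notin> X \<and> q \<noteq> c"
            using onlyz unfolding B'_def by blast
        qed
        moreover have "B' \<subseteq> W' \<times> (W' - R')" using BW W' True unfolding B'_def R'_def by auto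
        moreover have "(y, y) \<notin> B'" for y using irr unfolding B'_def by blast
        moreover have "R' \<subseteq> W'" using RW W' z unfolding R'_def by blast
        ultimately obtain f :: "'a \<Rightarrow> real" where inj: "inj_on f W'"
          and f: "\<forall>v \<in> W' - R'. \<exists>u w. (u, v) \<in> B' \<and> (w, v) \<in> B' \<and> f u < f v \<and> f v < f w"
          using IH[of R' B'] by blast
        have fwz: "f w \<noteq> f z" using inj wz z by (auto simp: inj_on_def)
        obtain t where t: "t \<notin> f ` W'" "min (f w) t < f z" "f z < max (f w) t"
        proof (cases "f w < f z")
          case True
          obtain t where "f z < t" "t \<notin> f ` W'"
            using fresh_between[of "f ` W'" "f z" "f z + 1"] W' by auto
          then show thesis using that[of t] True by simp
        next
          case False
          obtain t where "t < f z" "t \<notin> f ` W'"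
            using fresh_between[of "f ` W'" "f z - 1" "f z"] W' by auto
          then show thesis using that[of t] False fwz by simp
        qed
        have "?good (f(x := t)) W R B"
        proof (intro conjI ballI)
          show "inj_on (f(x := t)) W" using inj t W' by (auto simp: inj_on_def)
          fix v assume v: "v \<in> W - R"
          show "\<exists>u w. (u, v) \<in> B \<and> (w, v) \<in> B \<and> (f(x := t)) u < (f(x := t)) v \<and> (f(x := t)) v < (f(x := t)) w"
          proof (cases "v = z")
            case True
            have "f w < f z \<and> f z < t \<or> t < f z \<and> f z < f w" using t by linarith
            then show ?thesis using True xz wz w(1) z(2) by auto
          next
            case False
            then have "v \<in> W' - R'" using v \<open>x \<in> R\<close> W' unfolding R'_def by blast
            then obtain u w' where "(u, v) \<in> B'" "(w', v) \<in> B'" "f u < f v" "f v < f w'"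
              using f by blast
            moreover have "v \<noteq> x" using v \<open>x \<in> R\<close> by blast
            ultimately show ?thesis unfolding B'_def by auto
          qed
        qed
        then show ?thesis by blast
      next
        case False
        then have xU: "x \<in> W - R" using x by blast
        obtain u v where uv: "u \<noteq> v" "{q. (q, x) \<in> B} = {u, v}" using two[OF xU] by blast
        then have "(u, x) \<in> B" "(v, x) \<in> B" by auto
        then have uvx: "(u, x) \<in> B" "(v, x) \<in> B" "u \<noteq> x" "v \<noteq> x" "u \<in> W'" "v \<in> W'"
          using irr BW W' by blast+
        \<comment> \<open>Contraction of \<open>(x, z)\<close>: the inneighbours of \<open>x\<close>
          become inneighbours of \<open>z\<close>, except \<open>z\<close> itself, which would give
          a loop.\<close>
        define B' where "B' = {(q, v) \<in> B. q \<noteq> x \<and> v \<noteq> x} \<union> {(q, z) | q. (q, x) \<in> B \<and> q \<noteq> z}"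
        have "doubly_entered B' (W' - R)"
          unfolding doubly_entered_def
        proof (intro allI impI)
          fix X c assume X: "X \<subseteq> W' - R" "X \<noteq> {}"
          show "\<exists>q v. (q, v) \<in> B' \<and> v \<in> X \<and> q \<notin> X \<and> q \<noteq> c"
          proof (cases "z \<in> X")
            case True
            \<comment> \<open>A set containing the contracted vertex corresponds to one containing
              both ends, with the same entering tails.\<close>
            have "insert x X \<subseteq> W - R" using X xU W' by blast
            then obtain q y where "(q, y) \<in> B" "y \<in> insert x X" "q \<notin> insert x X" "q \<noteq> c"
              using doubly_enteredD[OF deB, of "insert x X"] by blast
            then show ?thesis using True irr unfolding B'_def by blast
          next
            case False
            have "X \<subseteq> W - R" using X W' by blast
            then obtain q y where "(q, y) \<in> B" "y \<in> X" "q \<notin> X" "q \<noteq> c"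
              using X doubly_enteredD[OF deB] by blast
            moreover then have "q \<noteq> x" "y \<noteq> x" using False onlyz X W' by blast+
            ultimately show ?thesis unfolding B'_def by blast
          qed
        qed
        moreover have "q \<in> W'" if "(q, x) \<in> B" for q using that uv(2) uvx(5,6) by auto
        then have "B' \<subseteq> W' \<times> (W' - R)" using BW W' z unfolding B'_def by auto
        moreover have "R \<subseteq> W'" using RW W' False by blast
        moreover have "(y, y) \<notin> B'" for y using irr unfolding B'_def by blast
        ultimately obtain f :: "'a \<Rightarrow> real" where inj: "inj_on f W'"
          and f: "\<forall>v \<in> W' - R. \<exists>u w. (u, v) \<in> B' \<and> (w, v) \<in> B' \<and> f u < f v \<and> f v < f w"
          using IH[of R B'] by blast
        \<comment> \<open>The inneighbours of \<open>z\<close> after contraction are among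
          \<open>w\<close>, \<open>u\<close> and \<open>v\<close>, which supplies the hypotheses of
          \<open>between_choice\<close>.\<close>
        have "\<exists>p q. (p, z) \<in> B' \<and> (q, z) \<in> B' \<and> f p < f z \<and> f z < f q" using f z by blast
        moreover have "q \<in> {w, u, v}" if "(q, z) \<in> B'" for q
          using that uv(2) w(2) unfolding B'_def by auto
        ultimately have "\<exists>p\<in>{f w, f u, f v}. p < f z" "\<exists>q\<in>{f w, f u, f v}. f z < q" by blast+
        moreover have "f u \<noteq> f v" "f w \<noteq> f z" using inj uvx wz z uv by (auto simp: inj_on_def)
        ultimately obtain a b where "a < b" and ab: "\<And>t. a < t \<Longrightarrow> t < b \<Longrightarrow>
            min (f u) (f v) < t \<and> t < max (f u) (f v) \<and> min (f w) t < f z \<and> f z < max (f w) t"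
          using between_choice[of "f u" "f v" "f w" "f z"] by blast
        then obtain t where "a < t" "t < b" and t: "t \<notin> f ` W'"
          using fresh_between[of "f ` W'"] W' by blast
        with ab have t': "min (f u) (f v) < t" "t < max (f u) (f v)" "min (f w) t < f z" "f z < max (f w) t"
          by blast+
        have "?good (f(x := t)) W R B"
        proof (intro conjI ballI)
          show "inj_on (f(x := t)) W" using inj t W' by (auto simp: inj_on_def)
          fix y assume y: "y \<in> W - R"
          consider "y = x" | "y = z" | "y \<noteq> x" "y \<noteq> z" by blast
          then show "\<exists>u w. (u, y) \<in> B \<and> (w, y) \<in> B \<and> (f(x := t)) u < (f(x := t)) y \<and> (f(x := t)) y < (f(x := t)) w"
          proof cases
            case 1
            have "f u < t \<and> t < f v \<or> f v < t \<and> t < f u" using t' by linarith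
            then show ?thesis using 1 uvx by auto
          next
            case 2
            have "f w < f z \<and> f z < t \<or> t < f z \<and> f z < f w" using t' by linarith
            then show ?thesis using 2 xz wz w(1) z(2) by auto
          next
            case 3
            then have "y \<in> W' - R" using y W' by blast
            then obtain p q where "(p, y) \<in> B'" "(q, y) \<in> B'" "f p < f y" "f y < f q"
              using f by blast
            then show ?thesis using 3 unfolding B'_def by auto
          qed
        qed
        then show ?thesis by blast
      qed
    qed
  qed
  then show ?case using BA by blast
qed

subsection \<open>Transversals and outbranchings\<close>

text \<open>Greedy choice: an element common to two sets settles at least two indices and uses one
  element of \<open>U\<close>, which pays for its weight 3. Once the sets are disjoint,
  \<open>2 * card I <= card U\<close>, and one element per set is cheap enough.\<close>

lemma small_transversal:
  assumes "finite U" "finite I" "\<And>i. i \<in> I \<Longrightarrow> G i \<subseteq> U \<and> 2 \<le> card (G i)"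
  shows "\<exists>S \<subseteq> U. (\<forall>i\<in>I. G i \<inter> S \<noteq> {}) \<and> 3 * card S \<le> card U + card I"
  using assms
proof (induction "card U" arbitrary: U I rule: less_induct)
  case less
  note finU = less.prems(1) and finI = less.prems(2) and G = less.prems(3)
  have finG: "finite (G i)" if "i \<in> I" for i using G[OF that] finU finite_subset by blast
  show ?case
  proof (cases "\<exists>x\<in>U. \<exists>i\<in>I. \<exists>j\<in>I. i \<noteq> j \<and> x \<in> G i \<and> x \<in> G j")
    case True
    then obtain x i j where x: "x \<in> U" "i \<in> I" "j \<in> I" "i \<noteq> j" "x \<in> G i" "x \<in> G j" by blast
    define I' where "I' = {i\<in>I. x \<notin> G i}"
    have cU: "card (U - {x}) + 1 = card U" using x(1) finU
      by (metis Suc_eq_plus1 card_Suc_Diff1)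
    have "G i \<subseteq> U - {x} \<and> 2 \<le> card (G i)" if "i \<in> I'" for i
      using G that unfolding I'_def by blast
    then obtain S where S: "S \<subseteq> U - {x}" "\<forall>i\<in>I'. G i \<inter> S \<noteq> {}"
      "3 * card S \<le> card (U - {x}) + card I'"
      using less.hyps[of "U - {x}" I'] cU finU finI unfolding I'_def by auto
    have "card (I' \<union> {i, j}) \<le> card I" using finI x unfolding I'_def by (intro card_mono) auto
    moreover have "card (I' \<union> {i, j}) = card I' + 2"
      using x finI unfolding I'_def by (subst card_Un_disjoint) auto
    moreover have "card (insert x S) \<le> card S + 1"
      using finite_subset[of S U] finU S(1) by (subst card_insert_if) auto
    ultimately have "3 * card (insert x S) \<le> card U + card I" using S(3) cU by linarith
    moreover have "\<forall>i\<in>I. G i \<inter> insert x S \<noteq> {}" using S(2) unfolding I'_def by blast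
    ultimately show ?thesis using S(1) x(1) by (intro exI[of _ "insert x S"]) blast
  next
    case False
    have "\<exists>x. x \<in> G i" if "i \<in> I" for i using G[OF that] by (metis card.empty ex_in_conv not_numeral_le_zero)
    then obtain h where h: "\<And>i. i \<in> I \<Longrightarrow> h i \<in> G i" by metis
    have "2 * card I = (\<Sum>i\<in>I. 2)" by simp
    also have "\<dots> \<le> (\<Sum>i\<in>I. card (G i))" using G by (intro sum_mono) blast
    also have "\<dots> = card (\<Union>i\<in>I. G i)"
      using finI finG False G by (subst card_UN_disjoint) blast+
    also have "\<dots> \<le> card U" using G finU by (intro card_mono) blast+
    finally have "2 * card I \<le> card U" .
    then have "3 * card (h ` I) \<le> card U + card I" using card_image_le[OF finI, of h] by linarith
    moreover have "h ` I \<subseteq> U" using h G by blast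
    ultimately show ?thesis using h by (intro exI[of _ "h ` I"]) blast
  qed
qed

lemma transversal_with_large_complement:
  assumes "finite W" "finite I" "card I \<le> card W" and F: "\<And>i. i \<in> I \<Longrightarrow> F i \<subseteq> W \<and> F i \<noteq> {}"
  shows "\<exists>S \<subseteq> W. (\<forall>i\<in>I. F i \<inter> S \<noteq> {}) \<and> card {i\<in>I. 2 \<le> card (F i)} \<le> 3 * card (W - S)"
proof -
  define I1 where "I1 = {i\<in>I. card (F i) < 2}"
  define I2 where "I2 = {i\<in>I. 2 \<le> card (F i)}"
  have fin: "finite I1" "finite I2" using assms unfolding I1_def I2_def by auto
  have cI: "card I = card I1 + card I2"
  proof -
    have "I = I1 \<union> I2" "I1 \<inter> I2 = {}" unfolding I1_def I2_def by auto
    then show ?thesis using fin card_Un_disjoint by blast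
  qed
  have "\<exists>x. F i = {x}" if "i \<in> I1" for i
  proof -
    have "finite (F i)" "F i \<noteq> {}" "card (F i) < 2"
      using that F assms(1) finite_subset unfolding I1_def by blast+
    then show ?thesis by (metis One_nat_def card_0_eq card_1_singletonE less_2_cases)
  qed
  then obtain h where h: "\<And>i. i \<in> I1 \<Longrightarrow> F i = {h i}" by metis
  define S0 where "S0 = h ` I1"
  define U where "U = W - S0"
  have S0: "S0 \<subseteq> W" using h F unfolding S0_def I1_def by blast
  have cS0: "card S0 \<le> card I1" unfolding S0_def using fin by (intro card_image_le)
  have cU: "card W = card S0 + card U" using S0 assms(1) unfolding U_def
    by (metis card_Diff_subset card_mono finite_subset le_add_diff_inverse)
  define J where "J = {i\<in>I2. F i \<inter> S0 = {}}"
  have cJ: "card J \<le> card I2" using fin unfolding J_def by (intro card_mono) auto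
  have "\<exists>S \<subseteq> U. (\<forall>i\<in>J. F i \<inter> S \<noteq> {}) \<and> 3 * card S \<le> card U + card J"
  proof (rule small_transversal)
    show "finite U" "finite J" using assms(1) fin unfolding U_def J_def by auto
    show "F i \<subseteq> U \<and> 2 \<le> card (F i)" if "i \<in> J" for i
      using that F unfolding U_def J_def I2_def by blast
  qed
  then obtain S where S: "S \<subseteq> U" "\<forall>i\<in>J. F i \<inter> S \<noteq> {}" "3 * card S \<le> card U + card J" by blast
  have "card U = card S + card (U - S)" using S(1) assms(1) unfolding U_def
    by (metis card_Diff_subset card_mono finite_Diff finite_subset le_add_diff_inverse)
  moreover have "card (U - S) = card (W - (S0 \<union> S))"
    unfolding U_def by (simp add: Diff_eq Int_assoc)
  ultimately have "card I2 \<le> 3 * card (W - (S0 \<union> S))"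
    using S(3) cU cI cJ cS0 assms(3) by linarith
  moreover have "F i \<inter> (S0 \<union> S) \<noteq> {}" if "i \<in> I" for i
  proof (cases "i \<in> I1")
    case True
    then show ?thesis using h unfolding S0_def by blast
  next
    case False
    then have "i \<in> I2" using that unfolding I1_def I2_def by auto
    then show ?thesis using S(2) unfolding J_def by blast
  qed
  moreover have "S0 \<union> S \<subseteq> W" using S0 S(1) unfolding U_def by blast
  ultimately show ?thesis unfolding I2_def by blast
qed

section \<open>Building and extending outbranchings\<close>

lemma outbranching_attach:
  assumes B: "is_outbranching Y A r B" "B \<subseteq> Y \<times> Y" "r \<in> Y" and XY: "X \<inter> Y = {}"
    and p: "\<And>x. x \<in> X \<Longrightarrow> p x \<in> Y \<and> (p x, x) \<in> A"
  shows "is_outbranching (Y \<union> X) A r (B \<union> (\<lambda>x. (p x, x)) ` X)"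
    and "X \<subseteq> leaves (Y \<union> X) (B \<union> (\<lambda>x. (p x, x)) ` X)"
    and "B \<union> (\<lambda>x. (p x, x)) ` X \<subseteq> (Y \<union> X) \<times> (Y \<union> X)"
proof -
  let ?B = "B \<union> (\<lambda>x. (p x, x)) ` X"
  have inY: "in_nbrs ?B v = in_nbrs B v" if "v \<in> Y" for v
    using that XY unfolding in_nbrs_def by auto
  have inX: "in_nbrs ?B v = {p v}" if "v \<in> X" for v
    using that XY B(2) unfolding in_nbrs_def by auto
  have reach: "(r, v) \<in> ?B\<^sup>*" if "v \<in> Y" for v
    using that B(1) rtrancl_mono[of B ?B] unfolding is_outbranching_def by blast
  have "(r, v) \<in> ?B\<^sup>*" if "v \<in> X" for v
    using reach[of "p v"] p[OF that] that by (meson UnCI imageI rtrancl.rtrancl_into_rtrancl)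
  with reach have "\<forall>v \<in> Y \<union> X. (r, v) \<in> ?B\<^sup>*" by blast
  moreover have "card (in_nbrs ?B v) = 1" if "v \<in> Y \<union> X - {r}" for v
    using that inX inY[of v] B(1) unfolding is_outbranching_def by (cases "v \<in> X") auto
  moreover have "?B \<subseteq> A" using B(1) p unfolding is_outbranching_def by auto
  ultimately show "is_outbranching (Y \<union> X) A r ?B"
    using inY[OF B(3)] B(1) unfolding is_outbranching_def by auto
  show "X \<subseteq> leaves (Y \<union> X) ?B"
    using B(2) XY p unfolding leaves_def out_nbrs_def by auto
  show "?B \<subseteq> (Y \<union> X) \<times> (Y \<union> X)" using B(2) p by auto
qed

text \<open>Adding an arc \<open>(a, b)\<close> that leaves \<open>Y\<close> destroys at most the
  leaf \<open>a\<close> and creates the leaf \<open>b\<close>. Hence any partial outbranching yields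
  a lower bound for leaves in \<open>V\<close>.\<close>

lemma outbranching_extend:
  assumes "finite V" "Y \<subseteq> V" "r \<in> Y" "\<And>v. v \<in> V \<Longrightarrow> (r, v) \<in> (A \<inter> V \<times> V)\<^sup>*"
    and "is_outbranching Y A r B" "B \<subseteq> Y \<times> Y"
  shows "\<exists>B'. is_outbranching V A r B' \<and> B' \<subseteq> V \<times> V \<and> card (leaves Y B) \<le> card (leaves V B')"
  using assms
proof (induction "card (V - Y)" arbitrary: Y B rule: less_induct)
  case less
  show ?case
  proof (cases "Y = V")
    case True
    then show ?thesis using less.prems by blast
  next
    case False
    have "\<exists>a\<in>Y. \<exists>b\<in>V - Y. (a, b) \<in> A"
    proof (rule ccontr)
      assume none: "\<not> ?thesis"
      have "v \<in> Y" if "(r, v) \<in> (A \<inter> V \<times> V)\<^sup>*" for v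
        using that by (induction rule: rtrancl_induct) (use less.prems none in auto)
      then show False using less.prems False by blast
    qed
    then obtain a b where ab: "a \<in> Y" "b \<in> V" "b \<notin> Y" "(a, b) \<in> A" by blast
    define B' where "B' = B \<union> (\<lambda>x. (a, x)) ` {b}"
    have B': "is_outbranching (Y \<union> {b}) A r B'" "{b} \<subseteq> leaves (Y \<union> {b}) B'"
      "B' \<subseteq> (Y \<union> {b}) \<times> (Y \<union> {b})"
      using outbranching_attach[of Y A r B "{b}" "\<lambda>_. a"] less.prems ab unfolding B'_def by auto
    have finY: "finite (leaves Y B)" "finite (leaves (Y \<union> {b}) B')"
      using less.prems finite_subset unfolding leaves_def by fastforce+
    have "leaves Y B - {a} \<subseteq> leaves (Y \<union> {b}) B'" "b \<notin> leaves Y B"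
      using ab unfolding B'_def leaves_def out_nbrs_def by auto
    then have "insert b (leaves Y B - {a}) \<subseteq> leaves (Y \<union> {b}) B'" "b \<notin> leaves Y B - {a}"
      using B'(2) by blast+
    then have "card (leaves Y B - {a}) + 1 \<le> card (leaves (Y \<union> {b}) B')"
      using finY by (metis Suc_eq_plus1 card_insert_disjoint card_mono finite_Diff)
    moreover have "card (leaves Y B) \<le> card (leaves Y B - {a}) + 1"
      using diff_card_le_card_Diff[of "{a}" "leaves Y B"] by simp
    ultimately have leaf_count: "card (leaves Y B) \<le> card (leaves (Y \<union> {b}) B')" by linarith
    have "card (V - (Y \<union> {b})) < card (V - Y)"
      using ab less.prems by (intro psubset_card_mono) auto
    moreover have "Y \<union> {b} \<subseteq> V" using ab less.prems by blast
    ultimately obtain B'' where "is_outbranching V A r B''" "B'' \<subseteq> V \<times> V"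
      "card (leaves (Y \<union> {b}) B') \<le> card (leaves V B'')"
      using less.hyps[of "Y \<union> {b}" B'] less.prems B' by blast
    moreover from this have "card (leaves Y B) \<le> card (leaves V B'')" using leaf_count by linarith
    ultimately show ?thesis by blast
  qed
qed

text \<open>Finiteness and acyclicity make the parent relation well-founded, so climbing from any
  vertex ends at \<open>r\<close>.\<close>

lemma parents_outbranching:
  assumes "finite V" "r \<in> V" and p: "\<And>v. v \<in> V - {r} \<Longrightarrow> p v \<in> V \<and> (p v, v) \<in> A"
    and ac: "acyclic ((\<lambda>v. (p v, v)) ` (V - {r}))"
  shows "is_outbranching V A r ((\<lambda>v. (p v, v)) ` (V - {r}))"
    and "leaves V ((\<lambda>v. (p v, v)) ` (V - {r})) = V - p ` (V - {r})"
proof -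
  let ?B = "(\<lambda>v. (p v, v)) ` (V - {r})"
  have "wf ?B" using ac assms(1) by (intro finite_acyclic_wf) auto
  then have "v \<in> V \<longrightarrow> (r, v) \<in> ?B\<^sup>*" for v
  proof (induction v rule: wf_induct_rule)
    case (less v)
    show ?case
    proof
      assume v: "v \<in> V"
      show "(r, v) \<in> ?B\<^sup>*"
      proof (cases "v = r")
        case False
        then have "(p v, v) \<in> ?B" "p v \<in> V" using v p by auto
        then show ?thesis using less.IH by (meson rtrancl.rtrancl_into_rtrancl)
      qed simp
    qed
  qed
  moreover have "in_nbrs ?B v = {p v}" if "v \<in> V - {r}" for v
    using that unfolding in_nbrs_def by auto
  moreover have "in_nbrs ?B r = {}" unfolding in_nbrs_def by auto
  ultimately show "is_outbranching V A r ?B"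
    using p unfolding is_outbranching_def by auto
  show "leaves V ?B = V - p ` (V - {r})" unfolding leaves_def out_nbrs_def by auto
qed

subsection \<open>Forward and backward trees\<close>

text \<open>The key of \<open>v\<close> lists the ancestors of \<open>v\<close> in the forest given by the parent function \<open>p\<close>,
  ending in \<open>v\<close>; the roots are the vertices outside \<open>U\<close>.\<close>

definition tree_keys :: "'a set \<Rightarrow> ('a \<Rightarrow> real) \<Rightarrow> ('a \<Rightarrow> 'a) \<Rightarrow> ('a \<Rightarrow> 'a list) \<Rightarrow> bool" where
  "tree_keys U f p key \<longleftrightarrow>
     (\<forall>v\<in>U. f (p v) < f v \<and> key v = key (p v) @ [v]) \<and> (\<forall>v. v \<notin> U \<longrightarrow> key v = [v])"

lemma tree_keys_exist:
  assumes "finite U" "\<And>v. v \<in> U \<Longrightarrow> f (p v) < f v"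
  obtains key where "tree_keys U f p key"
proof -
  define D where "D = (\<lambda>v. (p v, v)) ` U"
  have "f x < f y" if "(x, y) \<in> D\<^sup>+" for x y
    using that by induction (use assms(2) in \<open>force simp: D_def\<close>)+
  then have "acyclic D" unfolding acyclic_def by blast
  then have wf: "wf D" using assms(1) by (intro finite_acyclic_wf) (simp_all add: D_def)
  \<comment> \<open>Recursion along parent arcs, well-founded because \<open>f\<close> strictly
    increases along them.\<close>
  define key where "key = wfrec D (\<lambda>g v. if v \<in> U then g (p v) @ [v] else [v])"
  have "key v = (if v \<in> U then key (p v) @ [v] else [v])" for v
  proof -
    have "v \<in> U \<Longrightarrow> (p v, v) \<in> D" unfolding D_def by auto
    then show ?thesis
      unfolding key_def by (subst wfrec[OF wf]) (simp add: cut_apply)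
  qed
  then have "tree_keys U f p key" using assms(2) unfolding tree_keys_def by auto
  then show thesis using that by blast
qed

lemma tree_keysD:
  assumes "tree_keys U f p key"
  shows "v \<in> U \<Longrightarrow> f (p v) < f v" "v \<in> U \<Longrightarrow> key v = key (p v) @ [v]" "v \<notin> U \<Longrightarrow> key v = [v]"
  using assms unfolding tree_keys_def by blast+

lemma tree_keys_self: "tree_keys U f p key \<Longrightarrow> v \<in> set (key v)"
  using tree_keysD(2,3)[of U f p key v] by (cases "v \<in> U") auto

lemma tree_keys_le:
  assumes k: "tree_keys U f p key"
  shows "x \<in> set (key v) \<Longrightarrow> x = v \<or> f x < f v"
proof (induction "length (key v)" arbitrary: v rule: less_induct)
  case less
  show ?case
  proof (cases "v \<in> U")
    case True
    then show ?thesis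
      using less.hyps[of "p v"] less.prems tree_keysD(1,2)[OF k True] by force
  next
    case False
    then show ?thesis using less.prems tree_keysD(3)[OF k] by simp
  qed
qed

lemma tree_keys_subset:
  assumes k: "tree_keys U f p key" and W: "U \<subseteq> W" "p ` U \<subseteq> W"
  shows "v \<in> W \<Longrightarrow> set (key v) \<subseteq> W"
proof (induction "length (key v)" arbitrary: v rule: less_induct)
  case less
  show ?case
  proof (cases "v \<in> U")
    case True
    then show ?thesis
      using less.hyps[of "p v"] less.prems tree_keysD(2)[OF k True] W by auto
  next
    case False
    then show ?thesis using less.prems tree_keysD(3)[OF k] by simp
  qed
qed

lemma tree_keys_child:
  assumes k: "tree_keys U f p key"
  shows "x \<in> set (key v) \<Longrightarrow> x \<noteq> v \<Longrightarrow> \<exists>a\<in>set (key v). a \<in> U \<and> p a = x"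
proof (induction "length (key v)" arbitrary: v rule: less_induct)
  case less
  then have v: "v \<in> U" using tree_keysD(3)[OF k] by fastforce
  show ?case
  proof (cases "x = p v")
    case True
    then show ?thesis using v tree_keys_self[OF k] by blast
  next
    case False
    then show ?thesis
      using less.hyps[of "p v"] less.prems tree_keysD(2)[OF k v] by auto
  qed
qed

text \<open>Membership of \<open>v\<close> in \<open>key q\<close> says that \<open>q\<close> is
  \<open>v\<close> or a descendant of \<open>v\<close>. So these are the heads in \<open>U\<close>
  of arcs that are neither tree arcs nor arcs from a descendant.\<close>

definition exceptional :: "('a \<times> 'a) set \<Rightarrow> 'a set \<Rightarrow> ('a \<Rightarrow> 'a) \<Rightarrow> ('a \<Rightarrow> 'a list) \<Rightarrow> 'a set" where
  "exceptional A U p key = {v \<in> U. \<exists>q \<in> in_nbrs A v. q \<noteq> p v \<and> v \<notin> set (key q)}"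

text \<open>The lexicographic order inherits transitivity and irreflexivity, so keys strictly
  increase along walks.\<close>

lemma acyclic_lexord_key:
  assumes "trans R" "\<And>x. (x, x) \<notin> R"
  shows "acyclic {(q, v). (key q, key v) \<in> lexord R}"
proof -
  let ?D = "{(q, v). (key q, key v) \<in> lexord R}"
  have "(key q, key v) \<in> lexord R" if "(q, v) \<in> ?D\<^sup>+" for q v
    using that by induction (use assms(1) lexord_trans in blast)+
  then show ?thesis using lexord_irreflexive[of R] assms(2) unfolding acyclic_def by blast
qed

text \<open>A proper prefix is smaller in both orders; two incomparable lists are decided at their
  first difference, where \<open>f\<close> separates the entries.\<close>

lemma not_prefix_lexord:
  assumes "\<not> prefix ys xs" "inj_on f (set xs \<union> set ys)"
  shows "(xs, ys) \<in> lexord {(x, y). (f x :: real) < f y} \<or> (xs, ys) \<in> lexord {(x, y). f y < f x}"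
proof (cases "prefix xs ys")
  case True
  then obtain a zs where "ys = xs @ a # zs" using assms(1)
    by (metis append_Nil2 neq_Nil_conv prefix_def)
  then show ?thesis unfolding lexord_def by blast
next
  case False
  then have "xs \<parallel> ys" using assms(1) by (simp add: parallelI)
  then obtain as b bs c cs where *: "b \<noteq> c" "xs = as @ b # bs" "ys = as @ c # cs"
    using parallel_decomp[of xs ys] by metis
  then have "f b \<noteq> f c" using assms(2) by (auto simp: inj_on_def)
  then have "f b < f c \<or> f c < f b" by linarith
  then show ?thesis using * unfolding lexord_def by blast
qed

text \<open>The child \<open>a\<close> of \<open>v\<close> on the way to \<open>w v\<close> in the forward tree lies strictly between \<open>v\<close>
  and \<open>w v\<close>, so in the backward tree \<open>v\<close> is neither below \<open>a\<close> nor its parent.\<close>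

lemma exceptional_child:
  assumes kf: "tree_keys U f u kf" and kb: "tree_keys U (\<lambda>x. - f x) w kb"
    and v: "v \<in> U" "v \<in> set (kf (w v))" "(v, w v) \<notin> A"
    and arcs: "\<And>a. a \<in> U \<Longrightarrow> (u a, a) \<in> A"
  shows "v \<in> u ` exceptional A U w kb"
proof -
  have vw: "f v < f (w v)" using tree_keysD(1)[OF kb v(1)] by simp
  then obtain a where a: "a \<in> set (kf (w v))" "a \<in> U" "u a = v"
    using tree_keys_child[OF kf v(2)] by force
  then have "a \<noteq> w v" using arcs[OF a(2)] v(3) by auto
  then have aw: "f a < f (w v)" using tree_keys_le[OF kf a(1)] by blast
  have va: "f v < f a" using tree_keysD(1)[OF kf a(2)] a(3) by simp
  have "a \<notin> set (kb v)"
  proof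
    assume "a \<in> set (kb v)"
    then have "a \<in> set (kb (w v))" using tree_keysD(2)[OF kb v(1)] va by auto
    then show False using tree_keys_le[OF kb] aw by fastforce
  qed
  moreover have "v \<noteq> w a" using tree_keysD(1)[OF kb a(2)] va by auto
  ultimately have "a \<in> exceptional A U w kb"
    using a arcs[OF a(2)] unfolding exceptional_def in_nbrs_def by blast
  then show ?thesis using a(3) by blast
qed

text \<open>The other vertices of \<open>U\<close> look like inner vertices of a bipath, except that
  they may have further outneighbours.\<close>

definition special :: "('a \<times> 'a) set \<Rightarrow> 'a set \<Rightarrow> 'a set" where
  "special A U = {v \<in> U. \<not> (card (in_nbrs A v) = 2 \<and> in_nbrs A v \<subseteq> out_nbrs A v)}"

text \<open>Outside \<open>E\<close> and \<open>F\<close>, an inneighbour other than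
  \<open>u v\<close> is a forward descendant and lies above \<open>v\<close>, while one other than
  \<open>w v\<close> is a backward descendant and lies below \<open>v\<close>. So only
  \<open>u v\<close> and \<open>w v\<close> remain, and a missing opposite arc makes
  \<open>v\<close> the parent of an exceptional vertex.\<close>

lemma special_subset_exceptional:
  assumes kf: "tree_keys U f u kf" and kb: "tree_keys U (\<lambda>x. - f x) w kb"
    and arcs: "\<And>a. a \<in> U \<Longrightarrow> (u a, a) \<in> A" "\<And>a. a \<in> U \<Longrightarrow> (w a, a) \<in> A"
    and irr: "\<And>a. (a, a) \<notin> A"
  defines "E \<equiv> exceptional A U u kf" and "F \<equiv> exceptional A U w kb"
  shows "special A U \<subseteq> E \<union> F \<union> u ` F \<union> w ` E"
proof
  fix v assume sp: "v \<in> special A U"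
  then have v: "v \<in> U" unfolding special_def by blast
  show "v \<in> E \<union> F \<union> u ` F \<union> w ` E"
  proof (rule ccontr)
    assume no: "v \<notin> E \<union> F \<union> u ` F \<union> w ` E"
    have uvw: "f (u v) < f v" "f v < f (w v)"
      using tree_keysD(1)[OF kf v] tree_keysD(1)[OF kb v] by auto
    have inU: "v \<in> set (kf q)" if "q \<in> in_nbrs A v" "q \<noteq> u v" for q
      using that no v unfolding E_def exceptional_def by blast
    have inW: "v \<in> set (kb q)" if "q \<in> in_nbrs A v" "q \<noteq> w v" for q
      using that no v unfolding F_def exceptional_def by blast
    have nb: "u v \<in> in_nbrs A v" "w v \<in> in_nbrs A v"
      using arcs v unfolding in_nbrs_def by blast+
    have "q = u v \<or> q = w v" if q: "q \<in> in_nbrs A v" for q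
    proof (rule ccontr)
      assume "\<not> ?thesis"
      moreover have "q \<noteq> v" using q irr unfolding in_nbrs_def by blast
      ultimately show False
        using tree_keys_le[OF kf inU[OF q]] tree_keys_le[OF kb inW[OF q]] by auto
    qed
    then have N: "in_nbrs A v = {u v, w v}" using nb by blast
    moreover have ne: "u v \<noteq> w v" using uvw by auto
    ultimately have "card (in_nbrs A v) = 2" by simp
    then have "(v, u v) \<notin> A \<or> (v, w v) \<notin> A"
      using sp N unfolding special_def out_nbrs_def by auto
    then show False
    proof
      assume "(v, w v) \<notin> A"
      then have "v \<in> u ` F"
        unfolding F_def using exceptional_child[OF kf kb v _ _ arcs(1)] inU[OF nb(2)] ne by auto
      then show False using no by blast
    next
      assume "(v, u v) \<notin> A"
      \<comment> \<open>Negating \<open>f\<close> twice exchanges the two trees, so the same lemma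
        covers the mirror case.\<close>
      moreover have "tree_keys U (\<lambda>x. - (- f x)) u kf" using kf by simp
      ultimately have "v \<in> w ` E"
        unfolding E_def using exceptional_child[OF kb _ v _ _ arcs(2)] inW[OF nb(1)] ne by auto
      then show False using no by blast
    qed
  qed
qed

subsection \<open>Reduced digraphs with few leaves\<close>

text \<open>The negated conclusion, to be refuted with \<open>l = k - 1\<close>.\<close>

locale few_leaves =
  fixes V :: "'a set" and A :: "('a \<times> 'a) set" and r :: 'a and l :: nat
  assumes rooted: "rooted_digraph V A r"
    and reduced: "reduced V A r"
    and few: "\<And>B. is_outbranching V A r B \<Longrightarrow> card (leaves V B) \<le> l"
begin

abbreviation "W \<equiv> V - {r}"
abbreviation "R \<equiv> out_nbrs A r"
abbreviation "U \<equiv> V - {r} - out_nbrs A r"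

lemma
  shows finite_V: "finite V" and arcs_V: "A \<subseteq> V \<times> V" and root_V: "r \<in> V"
    and irr: "(v, v) \<notin> A" and no_in_root: "(v, r) \<notin> A"
    and in_R: "(v, y) \<in> A \<Longrightarrow> v \<noteq> r \<Longrightarrow> y \<notin> R"
  using rooted unfolding rooted_digraph_def by blast+

lemma in_nbrs_U: "v \<in> U \<Longrightarrow> in_nbrs A v \<subseteq> W"
  using arcs_V unfolding in_nbrs_def out_nbrs_def by blast

lemma R_subset: "R \<subseteq> W"
  using arcs_V no_in_root unfolding out_nbrs_def by blast

lemma finite_nbrs: "finite (in_nbrs A v)"
  by (rule finite_subset[OF _ finite_V]) (use arcs_V in \<open>auto simp: in_nbrs_def\<close>)

lemma reach: "v \<in> V \<Longrightarrow> (r, v) \<in> A\<^sup>*"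
  using reduced unfolding reduced_def rule0_applies_def by blast

text \<open>If only \<open>c\<close> had arcs into \<open>X\<close>, then \<open>c\<close> would be
  a cutvertex, or \<open>X\<close> would not be reachable at all. Arcs from \<open>r\<close> may be
  dropped since they never enter \<open>U\<close>.\<close>

lemma doubly_entered_U: "doubly_entered (A \<inter> W \<times> W) U"
  unfolding doubly_entered_def
proof (intro allI impI)
  fix X c assume X: "X \<subseteq> U" "X \<noteq> {}"
  show "\<exists>q v. (q, v) \<in> A \<inter> W \<times> W \<and> v \<in> X \<and> q \<notin> X \<and> q \<noteq> c"
  proof (rule ccontr)
    assume "\<not> ?thesis"
    then have only: "q = c" if "(q, v) \<in> A" "v \<in> X" "q \<notin> X" for q v
      using that X arcs_V in_nbrs_U[of v] unfolding in_nbrs_def by blast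
    obtain z where z: "z \<in> X" using X by blast
    show False
    proof (cases "c \<in> W - X")
      case True
      have "v \<notin> X" if "(r, v) \<in> (A \<inter> (V - {c}) \<times> (V - {c}))\<^sup>*" for v
        using that by (induction rule: rtrancl_induct) (use X only in auto)
      then have "\<not> reach_avoiding V A {c} r z" using z unfolding reach_avoiding_def by blast
      moreover have "z \<in> V - {c}" using z True X by blast
      ultimately have "is_cutvertex V A r c"
        using True unfolding is_cutvertex_def is_cut_def by blast
      then show False using reduced unfolding reduced_def rule1_applies_def by blast
    next
      case False
      have "v \<notin> X" if "(r, v) \<in> A\<^sup>*" for v
        using that
      proof (induction rule: rtrancl_induct)
        case (step y v)
        have "y \<in> W" if "v \<in> X" using in_nbrs_U[of v] step(2) that X unfolding in_nbrs_def by blast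
        then show ?case using step only False by blast
      qed (use X in blast)
      then show False using reach z X by blast
    qed
  qed
qed

text \<open>Rule (3) makes every in-neighbour of \<open>z\<close> adjacent from the part of the digraph
  reachable while avoiding all of them, so all of them can be leaves simultaneously.\<close>

lemma indegree_le:
  assumes z: "z \<in> U"
  shows "card (in_nbrs A z) \<le> l"
proof -
  define N where "N = in_nbrs A z"
  define Y where "Y = {v. (r, v) \<in> (A \<inter> (V - N) \<times> (V - N))\<^sup>*}"
  have NW: "N \<subseteq> W" using in_nbrs_U[OF z] unfolding N_def .
  have rY: "r \<in> Y" unfolding Y_def by simp
  have YV: "Y \<subseteq> V - N"
  proof
    fix v assume "v \<in> Y"
    then have "(r, v) \<in> (A \<inter> (V - N) \<times> (V - N))\<^sup>*" unfolding Y_def by simp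
    then show "v \<in> V - N" by (induction rule: rtrancl_induct) (use NW root_V in auto)
  qed
  \<comment> \<open>Otherwise a walk from \<open>r\<close> avoiding the other inneighbours of
    \<open>z\<close> could never leave \<open>Y\<close>, contrary to the failure of rule
    (3).\<close>
  have "\<exists>x\<in>Y. (x, y) \<in> A" if y: "y \<in> N" for y
  proof (rule ccontr)
    assume none: "\<not> ?thesis"
    have "v \<in> Y" if "(r, v) \<in> (A \<inter> (V - (N - {y})) \<times> (V - (N - {y})))\<^sup>*" for v
      using that
    proof (induction rule: rtrancl_induct)
      case (step a b)
      then have ab: "(a, b) \<in> A" "a \<in> Y" by blast+
      then have "b \<noteq> y" using none by blast
      then have "(a, b) \<in> A \<inter> (V - N) \<times> (V - N)" using step(2) YV ab by blast
      then show ?case using ab(2) unfolding Y_def by (auto intro: rtrancl.rtrancl_into_rtrancl)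
    qed (rule rY)
    moreover have "reach_avoiding V A (N - {y}) r y"
      using reduced z y unfolding reduced_def rule3_applies_def cuts_from_root_def N_def by blast
    ultimately have "y \<in> Y" unfolding reach_avoiding_def by blast
    then show False using YV y by blast
  qed
  then obtain p where p: "\<And>y. y \<in> N \<Longrightarrow> p y \<in> Y \<and> (p y, y) \<in> A" by metis
  have "(r, v) \<in> (A \<inter> Y \<times> Y)\<^sup>*" if "v \<in> Y" for v
  proof -
    have "(r, v) \<in> (A \<inter> (V - N) \<times> (V - N))\<^sup>*" using that unfolding Y_def by simp
    then show ?thesis
    proof (induction rule: rtrancl_induct)
      case (step a b)
      then have "a \<in> Y" "b \<in> Y" unfolding Y_def by (auto intro: rtrancl.rtrancl_into_rtrancl)
      then show ?case using step by (auto intro: rtrancl.rtrancl_into_rtrancl)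
    qed simp
  qed
  moreover have "is_outbranching {r} A r {}" unfolding is_outbranching_def in_nbrs_def by simp
  moreover have "finite Y" using YV finite_V finite_subset by blast
  ultimately obtain B where B: "is_outbranching Y A r B" "B \<subseteq> Y \<times> Y"
    using outbranching_extend[of Y "{r}" r A "{}"] rY by blast
  define B' where "B' = B \<union> (\<lambda>x. (p x, x)) ` N"
  have B': "is_outbranching (Y \<union> N) A r B'" "N \<subseteq> leaves (Y \<union> N) B'"
    "B' \<subseteq> (Y \<union> N) \<times> (Y \<union> N)"
    using outbranching_attach[OF B rY, of N p] YV p unfolding B'_def by blast+
  have AV: "A \<inter> V \<times> V = A" using arcs_V by blast
  have YN: "Y \<union> N \<subseteq> V" using YV NW by blast
  have "\<exists>B''. is_outbranching V A r B'' \<and> B'' \<subseteq> V \<times> V \<and>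
      card (leaves (Y \<union> N) B') \<le> card (leaves V B'')"
    by (rule outbranching_extend[OF finite_V YN _ _ B'(1,3)]) (use rY reach AV in auto)
  then obtain B'' where B'': "is_outbranching V A r B''"
      "card (leaves (Y \<union> N) B') \<le> card (leaves V B'')"
    by blast
  have "finite (leaves (Y \<union> N) B')"
    using finite_V finite_subset[OF YN] unfolding leaves_def by simp
  then have "card N \<le> card (leaves (Y \<union> N) B')" using B'(2) by (intro card_mono)
  then show ?thesis using B''(2) few[OF B''(1)] unfolding N_def by linarith
qed

text \<open>The star from \<open>r\<close> to its outneighbours is a partial outbranching with all
  of \<open>R\<close> as leaves.\<close>

lemma root_outdegree_le: "card R \<le> l"
proof -
  have B0: "is_outbranching {r} A r {}" unfolding is_outbranching_def in_nbrs_def by simp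
  define B where "B = {} \<union> (\<lambda>x. (r, x)) ` R"
  have "{} \<subseteq> {r} \<times> {r}" "r \<in> {r}" "R \<inter> {r} = {}" using R_subset by blast+
  moreover have "\<And>x. x \<in> R \<Longrightarrow> r \<in> {r} \<and> (r, x) \<in> A" by (simp add: out_nbrs_def)
  ultimately have B: "is_outbranching ({r} \<union> R) A r B" "R \<subseteq> leaves ({r} \<union> R) B"
    "B \<subseteq> ({r} \<union> R) \<times> ({r} \<union> R)"
    using outbranching_attach[OF B0, where X = R and p = "\<lambda>_. r", folded B_def] by blast+
  have AV: "A \<inter> V \<times> V = A" using arcs_V by blast
  have YN: "{r} \<union> R \<subseteq> V" using R_subset root_V by blast
  have "\<exists>B''. is_outbranching V A r B'' \<and> B'' \<subseteq> V \<times> V \<and>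
      card (leaves ({r} \<union> R) B) \<le> card (leaves V B'')"
    by (rule outbranching_extend[OF finite_V YN _ _ B(1,3)]) (use reach AV in auto)
  then obtain B'' where B'': "is_outbranching V A r B''"
      "card (leaves ({r} \<union> R) B) \<le> card (leaves V B'')"
    by blast
  have "finite (leaves ({r} \<union> R) B)"
    using finite_V finite_subset[OF YN] unfolding leaves_def by simp
  then have "card R \<le> card (leaves ({r} \<union> R) B)" using B(2) by (intro card_mono)
  then show ?thesis using B''(2) few[OF B''(1)] by linarith
qed

text \<open>Parents of \<open>U\<close> are taken from a transversal \<open>S\<close> of the
  inneighbourhoods in \<open>D\<close>, and parents of \<open>R\<close> are \<open>r\<close>.
  Everything in \<open>W - S\<close> is then a leaf, and there are at most \<open>l\<close>
  leaves.\<close>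

lemma acyclic_multiple_entries_le:
  assumes D: "acyclic D" "D \<subseteq> A" and ent: "\<And>v. v \<in> U \<Longrightarrow> in_nbrs D v \<noteq> {}"
  shows "card {v \<in> U. 2 \<le> card (in_nbrs D v)} \<le> 3 * l"
proof -
  have sub: "in_nbrs D v \<subseteq> W" if "v \<in> U" for v
    using in_nbrs_U[OF that] D(2) unfolding in_nbrs_def by blast
  have "card U \<le> card W" using finite_V by (intro card_mono) auto
  then have "\<exists>S \<subseteq> W. (\<forall>v\<in>U. in_nbrs D v \<inter> S \<noteq> {}) \<and>
      card {v \<in> U. 2 \<le> card (in_nbrs D v)} \<le> 3 * card (W - S)"
    by (intro transversal_with_large_complement) (use finite_V sub ent in simp_all)
  then obtain S where S: "S \<subseteq> W" "\<forall>v\<in>U. in_nbrs D v \<inter> S \<noteq> {}"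
    "card {v \<in> U. 2 \<le> card (in_nbrs D v)} \<le> 3 * card (W - S)"
    by blast
  then have "\<exists>q. q \<in> in_nbrs D v \<inter> S" if "v \<in> U" for v using that by blast
  then obtain h where h: "\<And>v. v \<in> U \<Longrightarrow> h v \<in> in_nbrs D v \<inter> S" by metis
  define p where "p v = (if v \<in> R then r else h v)" for v
  have p: "p v \<in> V \<and> (p v, v) \<in> A" if "v \<in> V - {r}" for v
    using that h[of v] D(2) S(1) root_V unfolding p_def in_nbrs_def out_nbrs_def by auto
  let ?B = "(\<lambda>v. (p v, v)) ` (V - {r})"
  \<comment> \<open>Walks not starting at \<open>r\<close> use only arcs of \<open>D\<close>,
    because the arcs to \<open>R\<close> all start at \<open>r\<close>.\<close>
  have "(y, x) \<in> D\<^sup>+ \<and> x \<noteq> r" if "(y, x) \<in> ?B\<^sup>+" "y \<noteq> r" for y x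
  proof -
    have step: "(a, b) \<in> D \<and> b \<noteq> r" if "(a, b) \<in> ?B" "a \<noteq> r" for a b
      using that h[of b] unfolding p_def in_nbrs_def by (auto split: if_splits)
    show ?thesis
      using that by induction (use step in \<open>blast intro: trancl.intros\<close>)+
  qed
  moreover have "(r, r) \<notin> ?B\<^sup>+"
  proof
    assume "(r, r) \<in> ?B\<^sup>+"
    then obtain y where "(y, r) \<in> ?B" by (meson tranclE)
    then show False by auto
  qed
  ultimately have ac: "acyclic ?B" using D(1) unfolding acyclic_def by blast
  have "p ` W \<subseteq> insert r S" using h unfolding p_def by auto
  then have "W - S \<subseteq> leaves V ?B"
    using parents_outbranching(2)[OF finite_V root_V p ac] by blast
  then have "card (W - S) \<le> card (leaves V ?B)"
    using finite_V by (intro card_mono) (auto simp: leaves_def)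
  then show ?thesis
    using few[OF parents_outbranching(1)[OF finite_V root_V p ac]] S(3) by linarith
qed

text \<open>Comparing keys lexicographically, with siblings ordered by \<open>f\<close> or against \<open>f\<close>, gives two
  linear orders extending the tree order such that every nondescendant of \<open>v\<close> precedes \<open>v\<close> in
  at least one of them. So every exceptional vertex has two inneighbours in one of two acyclic
  digraphs containing the tree.\<close>

lemma exceptional_le:
  assumes k: "tree_keys U f p key" and inj: "inj_on f W" and arc: "\<And>v. v \<in> U \<Longrightarrow> (p v, v) \<in> A"
  shows "card (exceptional A U p key) \<le> 6 * l"
proof -
  define D where "D L = A \<inter> {(q, v). (key q, key v) \<in> lexord L}" for L
  define E where "E L = {v \<in> U. 2 \<le> card (in_nbrs (D L) v)}" for L
  define L1 where "L1 = {(x, y). f x < f y}"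
  define L2 where "L2 = {(x, y). f y < f x}"
  have pW: "p ` U \<subseteq> W" using arc in_nbrs_U unfolding in_nbrs_def by blast
  have parent: "p v \<in> in_nbrs (D L) v" if "v \<in> U" for v L
  proof -
    \<comment> \<open>The key of the parent is a proper prefix, hence smaller whatever
      \<open>L\<close> is.\<close>
    have "(key (p v), key v) \<in> lexord L"
      using tree_keysD(2)[OF k that] unfolding lexord_def by auto
    then show ?thesis using arc[OF that] unfolding D_def in_nbrs_def by blast
  qed
  have bound: "card (E L) \<le> 3 * l" if "trans L" "\<And>x. (x, x) \<notin> L" for L
    unfolding E_def
  proof (rule acyclic_multiple_entries_le)
    show "acyclic (D L)"
      unfolding D_def by (rule acyclic_subset[OF acyclic_lexord_key[OF that, of key]]) blast
    show "D L \<subseteq> A" unfolding D_def by blast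
    show "in_nbrs (D L) v \<noteq> {}" if "v \<in> U" for v using parent[OF that] by blast
  qed
  have two: "v \<in> E L" if "v \<in> U" "q \<in> in_nbrs (D L) v" "q \<noteq> p v" for q v L
  proof -
    have "finite (in_nbrs (D L) v)"
      by (rule finite_subset[OF _ finite_nbrs[of v]]) (auto simp: in_nbrs_def D_def)
    moreover have "{p v, q} \<subseteq> in_nbrs (D L) v" using that parent by blast
    ultimately have "card {p v, q} \<le> card (in_nbrs (D L) v)" by (rule card_mono)
    then show ?thesis using that(1,3) unfolding E_def by simp
  qed
  have "exceptional A U p key \<subseteq> E L1 \<union> E L2"
  proof
    fix v assume "v \<in> exceptional A U p key"
    then obtain q where v: "v \<in> U" and q: "(q, v) \<in> A" "q \<noteq> p v" "v \<notin> set (key q)"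
      unfolding exceptional_def in_nbrs_def by blast
    have "\<not> prefix (key v) (key q)"
      using q(3) tree_keys_self[OF k, of v] set_mono_prefix by blast
    moreover have "q \<in> W" using q(1) v in_nbrs_U unfolding in_nbrs_def by blast
    then have "set (key q) \<union> set (key v) \<subseteq> W"
      using tree_keys_subset[OF k _ pW] v by auto
    then have "inj_on f (set (key q) \<union> set (key v))" using inj inj_on_subset by blast
    ultimately have "(key q, key v) \<in> lexord L1 \<or> (key q, key v) \<in> lexord L2"
      unfolding L1_def L2_def by (rule not_prefix_lexord)
    then have "q \<in> in_nbrs (D L1) v \<or> q \<in> in_nbrs (D L2) v"
      using q(1) unfolding D_def in_nbrs_def by blast
    then show "v \<in> E L1 \<union> E L2" using two v q(2) by blast
  qed
  then have "card (exceptional A U p key) \<le> card (E L1 \<union> E L2)"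
    using finite_V by (intro card_mono) (auto simp: E_def)
  also have "\<dots> \<le> card (E L1) + card (E L2)" by (rule card_Un_le)
  also have "\<dots> \<le> 3 * l + 3 * l"
    by (intro add_mono bound) (auto simp: L1_def L2_def trans_def)
  finally show ?thesis by simp
qed

lemma numbering_parents:
  obtains f :: "'a \<Rightarrow> real" and u w where "inj_on f W"
    "\<And>v. v \<in> U \<Longrightarrow> (u v, v) \<in> A \<and> (w v, v) \<in> A \<and> f (u v) < f v \<and> f v < f (w v)"
proof -
  \<comment> \<open>Rootedness forbids arcs into \<open>R\<close> from vertices other than
    \<open>r\<close>, so \<open>R\<close> can serve as the unconstrained set of the
    numbering.\<close>
  have "A \<inter> W \<times> W \<subseteq> W \<times> U" using in_R by auto
  then obtain f :: "'a \<Rightarrow> real" where f: "inj_on f W"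
    "\<forall>v\<in>U. \<exists>u w. (u, v) \<in> A \<inter> W \<times> W \<and> (w, v) \<in> A \<inter> W \<times> W \<and> f u < f v \<and> f v < f w"
    using numbering[of W R "A \<inter> W \<times> W"] doubly_entered_U R_subset finite_V irr by blast
  then have "\<forall>v\<in>U. \<exists>u w. (u, v) \<in> A \<and> (w, v) \<in> A \<and> f u < f v \<and> f v < f w" by blast
  then obtain u where "\<forall>v\<in>U. \<exists>w. (u v, v) \<in> A \<and> (w, v) \<in> A \<and> f (u v) < f v \<and> f v < f w" by metis
  then obtain w where "\<forall>v\<in>U. (u v, v) \<in> A \<and> (w v, v) \<in> A \<and> f (u v) < f v \<and> f v < f (w v)" by metis
  then show thesis using that f(1) by blast
qed

text \<open>Lower inneighbours give a forward tree for \<open>f\<close>, upper ones a backward tree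
  for its negation. Each of the four covering sets has at most \<open>6 * l\<close>
  elements.\<close>

lemma special_le: "card (special A U) \<le> 24 * l"
proof -
  obtain f :: "'a \<Rightarrow> real" and u w where inj: "inj_on f W"
    and uw: "\<And>v. v \<in> U \<Longrightarrow> (u v, v) \<in> A \<and> (w v, v) \<in> A \<and> f (u v) < f v \<and> f v < f (w v)"
    using numbering_parents by blast
  have finU: "finite U" using finite_V by blast
  obtain kf where kf: "tree_keys U f u kf" using tree_keys_exist[OF finU, of f u] uw by blast
  obtain kb where kb: "tree_keys U (\<lambda>x. - f x) w kb"
    using tree_keys_exist[OF finU, of "\<lambda>x. - f x" w] uw by auto
  have inj': "inj_on (\<lambda>x. - f x) W" using inj by (auto simp: inj_on_def)
  let ?E = "exceptional A U u kf" and ?F = "exceptional A U w kb"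
  have fin: "finite ?E" "finite ?F"
    by (auto intro: finite_subset[OF _ finU] simp: exceptional_def)
  have c: "card ?E \<le> 6 * l" "card ?F \<le> 6 * l"
    using exceptional_le[OF kf inj] exceptional_le[OF kb inj'] uw by blast+
  have "special A U \<subseteq> ?E \<union> ?F \<union> u ` ?F \<union> w ` ?E"
    using special_subset_exceptional[OF kf kb] uw irr by blast
  then have "card (special A U) \<le> card (?E \<union> ?F \<union> u ` ?F \<union> w ` ?E)"
    using fin by (intro card_mono) auto
  also have "\<dots> \<le> card ?E + card ?F + card (u ` ?F) + card (w ` ?E)"
    by (meson add_mono card_Un_le le_trans order_refl)
  also have "\<dots> \<le> 24 * l"
    using c card_image_le[OF fin(2), of u] card_image_le[OF fin(1), of w] by linarith
  finally show ?thesis .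
qed

section \<open>Regular vertices, bipaths and the final count\<close>

definition "regular = U - special A U"

definition "outer = {x \<in> regular. \<exists>z \<in> special A U. (x, z) \<in> A}"

text \<open>Otherwise \<open>x\<close> and both its inneighbours have no arcs to special vertices,
  and together with the next neighbours they form a bipath of length 4, to which rule (2)
  applies.\<close>

lemma inner_has_outer_in_nbr:
  assumes x: "x \<in> regular - outer"
  shows "\<exists>y \<in> outer. y \<in> in_nbrs A x"
proof (rule ccontr)
  assume no: "\<not> ?thesis"
  obtain f :: "'a \<Rightarrow> real" and u w where inj: "inj_on f W"
    and uw: "\<And>v. v \<in> U \<Longrightarrow> (u v, v) \<in> A \<and> (w v, v) \<in> A \<and> f (u v) < f v \<and> f v < f (w v)"
    using numbering_parents by blast
  have N: "in_nbrs A y = {u y, w y}" if "y \<in> regular" for y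
  proof -
    have y: "y \<in> U" "card (in_nbrs A y) = 2" using that unfolding regular_def special_def by auto
    have "{u y, w y} \<subseteq> in_nbrs A y" "u y \<noteq> w y" using uw[OF y(1)] unfolding in_nbrs_def by auto
    then show ?thesis using y(2) finite_nbrs by (metis card_2_iff card_subset_eq)
  qed
  have sym_arc: "(y, z) \<in> A" if "y \<in> regular" "(z, y) \<in> A" for y z
    using that unfolding regular_def special_def in_nbrs_def out_nbrs_def by blast
  \<comment> \<open>An outneighbour of \<open>y\<close> is neither \<open>r\<close> nor in
    \<open>R\<close>, and being special would make \<open>y\<close> outer.\<close>
  have out: "z \<in> regular" if "y \<in> regular - outer" "(y, z) \<in> A" for y z
  proof -
    have "y \<noteq> r" using that(1) unfolding regular_def by blast
    then have "z \<in> U" using that(2) in_R arcs_V no_in_root by blast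
    then show ?thesis using that unfolding outer_def regular_def by blast
  qed
  have incident: "(y, z) \<in> A \<longleftrightarrow> z \<in> {u y, w y}" "(z, y) \<in> A \<longleftrightarrow> z \<in> {u y, w y}"
    if y: "y \<in> regular - outer" for y z
  proof -
    show "(z, y) \<in> A \<longleftrightarrow> z \<in> {u y, w y}" using N[of y] y unfolding in_nbrs_def by blast
    \<comment> \<open>Outneighbours of \<open>y\<close> are regular too, so every arc at
      \<open>y\<close> has its opposite.\<close>
    moreover have "(y, z) \<in> A \<longleftrightarrow> (z, y) \<in> A" using sym_arc[of y z] sym_arc[of z y] out[OF y] y by blast
    ultimately show "(y, z) \<in> A \<longleftrightarrow> z \<in> {u y, w y}" by blast
  qed
  have nbr: "y \<in> regular - outer" if "y \<in> {u x, w x}" for y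
    using that incident[OF x] out[OF x] no unfolding in_nbrs_def by blast
  have U: "y \<in> U" if "y \<in> regular - outer" for y using that unfolding regular_def by blast
  define a b where "a = u x" and "b = w x"
  define c d where "c = u a" and "d = w b"
  have ab: "a \<in> regular - outer" "b \<in> regular - outer" using nbr unfolding a_def b_def by blast+
  have fx: "f a < f x" "f x < f b" using uw[OF U[OF x]] unfolding a_def b_def by auto
  have fc: "f c < f a" "f b < f d"
    using uw[OF U[OF ab(1)]] uw[OF U[OF ab(2)]] unfolding c_def d_def by auto
  have "x \<in> {u a, w a}" "x \<in> {u b, w b}"
    using incident(1)[OF x] incident(2)[OF ab(1)] incident(2)[OF ab(2)] unfolding a_def b_def by blast+
  \<comment> \<open>The vertex \<open>x\<close> is above \<open>a\<close> and below \<open>b\<close>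
    in the numbering, so it is the upper inneighbour of \<open>a\<close> and the lower one of
    \<open>b\<close>.\<close>
  then have wa: "w a = x" "u b = x" using fc fx unfolding c_def d_def by auto
  define xs where "xs = [c, a, x, b, d]"
  have inc: "(a, z) \<in> A \<longleftrightarrow> z = c \<or> z = x" "(z, a) \<in> A \<longleftrightarrow> z = c \<or> z = x"
    "(x, z) \<in> A \<longleftrightarrow> z = a \<or> z = b" "(z, x) \<in> A \<longleftrightarrow> z = a \<or> z = b"
    "(b, z) \<in> A \<longleftrightarrow> z = x \<or> z = d" "(z, b) \<in> A \<longleftrightarrow> z = x \<or> z = d" for z
    using incident[OF ab(1), of z] incident[OF x, of z] incident[OF ab(2), of z] wa
    unfolding a_def[symmetric] b_def[symmetric] c_def[symmetric] d_def[symmetric] by auto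
  have idx: "{g i | i. i + 1 < length xs} = {g 0, g 1, g 2, g (3 :: nat)}" for g :: "nat \<Rightarrow> 'a \<times> 'a"
  proof -
    have "i + 1 < length xs \<longleftrightarrow> i \<in> {0, 1, 2, 3}" for i unfolding xs_def by auto
    then show ?thesis by auto
  qed
  have "is_bipath V A xs"
    unfolding is_bipath_def
  proof (intro conjI)
    show "3 \<le> length xs" by (simp add: xs_def)
    \<comment> \<open>The numbering strictly increases along \<open>c, a, x, b, d\<close>, which in
      particular rules out \<open>c = d\<close>.\<close>
    show "distinct xs" using fx fc unfolding xs_def by auto
    have "(c, a) \<in> A" "(a, x) \<in> A" "(x, b) \<in> A" "(b, d) \<in> A" by (simp_all add: inc)
    then show "set xs \<subseteq> V" using arcs_V unfolding xs_def by auto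
    have "set (butlast (tl xs)) = {a, x, b}" by (simp add: xs_def)
    moreover have "{e \<in> A. fst e \<in> {a, x, b} \<or> snd e \<in> {a, x, b}} =
        {(c, a), (a, x), (x, b), (b, d), (a, c), (x, a), (b, x), (d, b)}"
    proof -
      \<comment> \<open>The incident arcs are split by inner vertex, so that the neighbourhoods in
        \<open>inc\<close> can be substituted.\<close>
      have eq1: "{e \<in> A. fst e \<in> Y \<or> snd e \<in> Y} =
          (\<Union>y\<in>Y. Pair y ` {z. (y, z) \<in> A} \<union> (\<lambda>z. (z, y)) ` {z. (z, y) \<in> A})" for Y
        by force
      have eq2: "{z. z = p \<or> z = q} = {p, q}" for p q :: 'a by auto
      show ?thesis
        unfolding eq1 UN_insert UN_empty inc eq2 image_insert image_empty by blast
    qed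
    moreover have "{(xs ! i, xs ! (i + 1)) | i. i + 1 < length xs} = {(c, a), (a, x), (x, b), (b, d)}"
      unfolding idx[of "\<lambda>i. (xs ! i, xs ! (i + 1))"] by (simp add: xs_def)
    moreover have "{(xs ! (i + 1), xs ! i) | i. i + 1 < length xs} = {(a, c), (x, a), (b, x), (d, b)}"
      unfolding idx[of "\<lambda>i. (xs ! (i + 1), xs ! i)"] by (simp add: xs_def)
    ultimately show "{e \<in> A. fst e \<in> set (butlast (tl xs)) \<or> snd e \<in> set (butlast (tl xs))} =
        {(xs ! i, xs ! (i + 1)) | i. i + 1 < length xs} \<union>
        {(xs ! (i + 1), xs ! i) | i. i + 1 < length xs}"
      by auto
  qed
  moreover have "length xs - 1 = 4" by (simp add: xs_def)
  ultimately show False using reduced unfolding reduced_def rule2_applies_def by blast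
qed

text \<open>The summands are 1 for the root, \<open>l\<close> for \<open>R\<close>,
  \<open>24 * l\<close> for special vertices, \<open>24 * l * l\<close> for outer ones and twice
  that for the remaining regular ones.\<close>

lemma card_V_le: "card V \<le> 1 + 25 * l + 72 * l * l"
proof -
  have fin: "finite U" "finite regular" "finite outer" "finite (special A U)"
    using finite_V unfolding regular_def outer_def special_def by auto
  have "outer \<subseteq> (\<Union>z\<in>special A U. in_nbrs A z)"
    unfolding outer_def in_nbrs_def by blast
  then have "card outer \<le> card (\<Union>z\<in>special A U. in_nbrs A z)"
    using fin finite_nbrs by (intro card_mono) auto
  also have "\<dots> \<le> (\<Sum>z\<in>special A U. card (in_nbrs A z))" by (rule card_UN_le[OF fin(4)])
  also have "\<dots> \<le> card (special A U) * l"
    using sum_bounded_above[of "special A U" "\<lambda>z. card (in_nbrs A z)" l] indegree_le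
    by (auto simp: special_def)
  also have "\<dots> \<le> 24 * l * l" using special_le by simp
  finally have outer: "card outer \<le> 24 * l * l" .
  have "regular - outer \<subseteq> (\<Union>y\<in>outer. in_nbrs A y)"
  proof
    fix x assume x: "x \<in> regular - outer"
    then obtain y where y: "y \<in> outer" "(y, x) \<in> A"
      using inner_has_outer_in_nbr unfolding in_nbrs_def by blast
    \<comment> \<open>Regularity of \<open>x\<close> reverses the arc, so \<open>x\<close> is one of
      only two inneighbours of the regular vertex \<open>y\<close>.\<close>
    then have "(x, y) \<in> A"
      using x unfolding regular_def special_def in_nbrs_def out_nbrs_def by blast
    then show "x \<in> (\<Union>y\<in>outer. in_nbrs A y)" using y(1) unfolding in_nbrs_def by blast
  qed
  then have "card (regular - outer) \<le> card (\<Union>y\<in>outer. in_nbrs A y)"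
    using fin finite_nbrs by (intro card_mono) auto
  also have "\<dots> \<le> (\<Sum>y\<in>outer. card (in_nbrs A y))" by (rule card_UN_le[OF fin(3)])
  also have "\<dots> = (\<Sum>y\<in>outer. 2)"
    by (rule sum.cong) (auto simp: outer_def regular_def special_def)
  finally have inner: "card (regular - outer) \<le> 2 * card outer" by simp
  have "V = {r} \<union> R \<union> special A U \<union> outer \<union> (regular - outer)"
    using root_V R_subset unfolding regular_def outer_def special_def by blast
  then have "card V = card ({r} \<union> R \<union> special A U \<union> outer \<union> (regular - outer))" by (rule arg_cong)
  also have "\<dots> \<le> card {r} + card R + card (special A U) + card outer + card (regular - outer)"
    by (intro order_trans[OF card_Un_le] add_mono order_refl)
  finally show ?thesis using root_outdegree_le special_le outer inner by simp
qed

end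

theorem theorem3:
  fixes V :: "'a set" and A :: "('a \<times> 'a) set" and r :: 'a and k :: nat
  assumes "k \<ge> 1"
    and "rooted_digraph V A r"
    and "reduced V A r"
    and "card V \<ge> (3 * k - 2) * (30 * k - 2)"
  shows "\<exists>B. is_outbranching V A r B \<and> card (leaves V B) \<ge> k"
proof (rule ccontr)
  assume no: "\<not> ?thesis"
  obtain l where k: "k = Suc l" using assms(1) by (cases k) auto
  have "few_leaves V A r l"
    using assms(2,3) no k by unfold_locales (auto simp: not_le less_Suc_eq_le)
  then have "card V \<le> 1 + 25 * l + 72 * l * l" by (rule few_leaves.card_V_le)
  \<comment> \<open>With \<open>k = Suc l\<close> the truncated subtractions disappear; the product
    is \<open>90 * l * l + 114 * l + 28\<close>, which exceeds the bound.\<close>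
  moreover have "(3 * k - 2) * (30 * k - 2) = (3 * l + 1) * (30 * l + 28)" using k by simp
  ultimately show False using assms(4) by (simp add: algebra_simps)
qed

end
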